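(* Every finite simple undirected connected graph $G$ on $n$ vertices satisfies $$\min\{s^+(G),s^-(G)\}\ge n-1.$$
   Context: All graphs are finite, simple, and undirected. For a graph $G$ with $n$ vertices and adjacency matrix $A=A(G)$, let $\lambda_1,\ldots,\lambda_n$ be the (real) eigenvalues of $A$, counted with multiplicity. The positive square energy and the negative square energy of $G$ are $$s^+(G):=\sum_{\lambda_i>0}\lambda_i^2,\qquad s^-(G):=\sum_{\lambda_i<0}\lambda_i^2.$$ *)

theory Defs
  imports
    Graph_Theory.Graph_Theory
    Jordan_Normal_Form.Char_Poly
begin

(* Finite simple undirected graphs are modelled by the locale "graph" (finite, loop-free,
   symmetric, no parallel arcs): an undirected edge is a pair of opposite arcs. *)

(* The list vs enumerates the vertices without repetition and fixes the order of the rows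
   and columns. Different enumerations give permutation-similar matrices. *)
definition adjacency_matrix :: "('a, 'b) pre_digraph \<Rightarrow> 'a list \<Rightarrow> real mat" where
  "adjacency_matrix G vs =
     mat (length vs) (length vs) (\<lambda>(i, j). if vs ! i \<rightarrow>\<^bsub>G\<^esub> vs ! j then 1 else 0)"

(* Algebraic multiplicities. For a real symmetric matrix the characteristic polynomial splits
   over the reals, so no eigenvalue is lost by taking real roots only. *)
definition eigenvalues_mset :: "real mat \<Rightarrow> real multiset" where
  "eigenvalues_mset A = proots (char_poly A)"

definition positive_square_energy :: "('a, 'b) pre_digraph \<Rightarrow> 'a list \<Rightarrow> real" where
  "positive_square_energy G vs =
     (\<Sum>x\<in>#filter_mset (\<lambda>x. x > 0) (eigenvalues_mset (adjacency_matrix G vs)). x\<^sup>2)"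

definition negative_square_energy :: "('a, 'b) pre_digraph \<Rightarrow> 'a list \<Rightarrow> real" where
  "negative_square_energy G vs =
     (\<Sum>x\<in>#filter_mset (\<lambda>x. x < 0) (eigenvalues_mset (adjacency_matrix G vs)). x\<^sup>2)"

end

theory Submission
  imports Defs
    Jordan_Normal_Form.Schur_Decomposition
    "HOL-Analysis.Convex"
    "HOL-Analysis.Function_Topology"
begin

text \<open>For a symmetric real matrix \<open>A\<close> write \<open>s\<^sup>+(A)\<close> for the sum of the squares of its positive eigenvalues.
Adding to \<open>A\<close> its negative part, a positive semidefinite matrix, leaves a matrix of squared
Frobenius norm \<open>s\<^sup>+(A)\<close>; and the negative square energy of \<open>A\<close> is \<open>s\<^sup>+(-A)\<close>. So it is enough
that \<open>\<parallel>\<plusminus>A + X\<parallel>\<^sup>2 \<ge> n - 1\<close> for \<^emph>\<open>every\<close> positive semidefinite \<open>X\<close>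
(\<open>psd_shift_to_positive_part\<close>, \<open>connected_shifted_energy\<close>). This form can be restricted to
principal submatrices and perturbed, with no eigenvalue in sight.

It is proved in a stronger form that survives deleting and splitting. The graph is a tree of connected
blocks \<open>W\<close>, any two of which meet in at most one vertex, and every block carries a real weight \<open>a W\<close> on
its edges. With \<open>A(a)\<close> the weighted adjacency matrix the claim is
\<open>\<parallel>A(a) + X\<parallel>\<^sup>2 \<ge> T(a)\<close>, where \<open>T(a) = (\<Sum>W. (a W)\<^sup>2 * (card W - 1))\<close>
(\<open>block_tree_energy_bound\<close>); a single block of weight \<open>1\<close> or \<open>-1\<close> is the case needed.

A block with a cut vertex is split there into two blocks of the same weight, which changes neither side.
Otherwise suppose that the claim fails. Both sides are homogeneous of degree two in \<open>(a, X)\<close>, so by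
compactness the left side has a minimum \<open>\<mu> < 1\<close> on \<open>T(a) = 1\<close>. Put \<open>P = A(a) + X\<close> at
a minimum. Varying the weight of one block gives \<open>\<langle>P, A\<^sub>W\<rangle> = \<mu> * a W * (card W - 1)\<close>, with the
same factor \<open>\<mu>\<close> for all blocks; making the deficit uniform is the purpose of the weights. Varying \<open>X\<close>
gives \<open>\<langle>P, X\<rangle> = 0\<close> and \<open>\<langle>P, Y\<rangle> \<ge> 0\<close> for positive semidefinite \<open>Y\<close>. Two arguments exclude this
situation.

If some block \<open>W\<close> of nonzero weight, with \<open>b \<ge> 3\<close> vertices, has at most \<open>(b - 1)\<^sup>2 / 2\<close> edges, delete
in turn each of its vertices together with everything that hangs from it, and add up the bounds for the
remaining, smaller, block trees. An entry of \<open>P\<close> between two branches of \<open>W\<close> survives \<open>b - 2\<close> of the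
deletions and every other entry \<open>b - 1\<close>. The sum therefore bounds the energy of \<open>P\<close> between
branches from above, and Cauchy-Schwarz on the edges of \<open>W\<close> bounds it from below
(\<open>no_sparse_block\<close>).

If no block of nonzero weight is like this, each has a proper colouring with \<open>c\<close> colours,
\<open>c * (b - 1) \<le> 2 * e\<close> for its \<open>e\<close> edges: complete blocks have \<open>e = b * (b - 1) / 2\<close> and \<open>c = b\<close>, and in
any other block two nonadjacent vertices can share a colour. Mapping the colours to the vertices of
a regular simplex and multiplying over the blocks gives a positive semidefinite \<open>M\<close> with unit diagonal and
entries \<open>- 1 / (c - 1)\<close> on the edges. Cauchy-Schwarz for \<open>P\<close> and the entrywise product of \<open>X\<close> with
\<open>M\<close> then contradicts \<open>\<mu> < 1\<close> (\<open>some_block_not_dense\<close>). For a single block this amounts to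
the lower bound of Ando and Lin, \<open>2 * e\<close> over the chromatic number. It has to be tight, as trees
(all blocks are single edges) attain the bound for both signs and complete graphs for the negative one.\<close>

section \<open>Positive semidefinite matrices\<close>

text \<open>Matrices are functions of two indices, looked at on a finite index set \<open>V\<close> only. So
passing to a principal submatrix means shrinking \<open>V\<close>.\<close>
definition frob :: "'a set \<Rightarrow> ('a \<Rightarrow> 'a \<Rightarrow> real) \<Rightarrow> ('a \<Rightarrow> 'a \<Rightarrow> real) \<Rightarrow> real" where
  "frob V X Y = (\<Sum>(u, v)\<in>V \<times> V. X u v * Y u v)"

definition psd :: "'a set \<Rightarrow> ('a \<Rightarrow> 'a \<Rightarrow> real) \<Rightarrow> bool" where
  "psd V X \<longleftrightarrow> (\<forall>u\<in>V. \<forall>v\<in>V. X u v = X v u) \<and> (\<forall>x. 0 \<le> (\<Sum>u\<in>V. \<Sum>v\<in>V. x u * X u v * x v))"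

lemma psd_sym: "psd V X \<Longrightarrow> u \<in> V \<Longrightarrow> v \<in> V \<Longrightarrow> X u v = X v u"
  by (simp add: psd_def)

lemma psd_quadratic: "psd V X \<Longrightarrow> 0 \<le> (\<Sum>u\<in>V. \<Sum>v\<in>V. x u * X u v * x v)"
  by (simp add: psd_def)

lemma psd_gram_imp:
  assumes "finite V" "\<And>u v. u \<in> V \<Longrightarrow> v \<in> V \<Longrightarrow> X u v = (\<Sum>k\<in>K. F k u * F k v)"
  shows "psd V X"
  unfolding psd_def
proof (intro conjI ballI allI)
  fix x :: "'a \<Rightarrow> real"
  have "(\<Sum>u\<in>V. \<Sum>v\<in>V. x u * X u v * x v) = (\<Sum>u\<in>V. \<Sum>v\<in>V. \<Sum>k\<in>K. (x u * F k u) * (x v * F k v))"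
    by (intro sum.cong refl) (simp add: assms(2) sum_distrib_left sum_distrib_right mult_ac)
  also have "\<dots> = (\<Sum>u\<in>V. \<Sum>k\<in>K. \<Sum>v\<in>V. (x u * F k u) * (x v * F k v))"
    by (intro sum.cong refl) (rule sum.swap)
  also have "\<dots> = (\<Sum>k\<in>K. \<Sum>u\<in>V. \<Sum>v\<in>V. (x u * F k u) * (x v * F k v))"
    by (rule sum.swap)
  also have "\<dots> = (\<Sum>k\<in>K. (\<Sum>u\<in>V. x u * F k u)\<^sup>2)"
    by (simp add: power2_eq_square sum_product)
  finally show "0 \<le> (\<Sum>u\<in>V. \<Sum>v\<in>V. x u * X u v * x v)" by (simp add: sum_nonneg)
qed (simp add: assms(2) mult.commute)

lemma psd_subset:
  assumes "psd V X" "U \<subseteq> V" "finite V"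
  shows "psd U X"
  unfolding psd_def
proof (intro conjI ballI allI)
  fix x :: "'a \<Rightarrow> real"
  define y where "y u = (if u \<in> U then x u else 0)" for u
  have "(\<Sum>u\<in>U. \<Sum>v\<in>U. x u * X u v * x v) = (\<Sum>u\<in>U. \<Sum>v\<in>U. y u * X u v * y v)"
    by (simp add: y_def)
  also have "\<dots> = (\<Sum>u\<in>U. \<Sum>v\<in>V. y u * X u v * y v)"
    by (intro sum.cong refl sum.mono_neutral_left) (use assms in \<open>auto simp: y_def\<close>)
  also have "\<dots> = (\<Sum>u\<in>V. \<Sum>v\<in>V. y u * X u v * y v)"
    by (intro sum.mono_neutral_left) (use assms in \<open>auto simp: y_def\<close>)
  finally show "0 \<le> (\<Sum>u\<in>U. \<Sum>v\<in>U. x u * X u v * x v)"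
    using psd_quadratic[OF assms(1), of y] by simp
qed (use assms in \<open>auto simp: psd_def\<close>)

text \<open>Cholesky factorisation: one index \<open>c\<close> at a time, by the Schur complement of the entry at \<open>(c, c)\<close>. When
that entry is zero, so is its whole row, and division by zero being zero makes the same formulas hold.\<close>
lemma psd_gram:
  assumes "finite V" "psd V X"
  obtains F where "\<And>u v. u \<in> V \<Longrightarrow> v \<in> V \<Longrightarrow> X u v = (\<Sum>k\<in>V. F k u * F k v)"
proof -
  have "\<exists>F. \<forall>u\<in>V. \<forall>v\<in>V. X u v = (\<Sum>k\<in>V. F k u * F k v)"
    using assms
  proof (induction V arbitrary: X rule: finite_induct)
    case (insert c V)
    have sym: "X u v = X v u" if "u \<in> insert c V" "v \<in> insert c V" for u v
      using psd_sym[OF insert.prems that] .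
    define l where "l x = (\<Sum>v\<in>V. X c v * x v)" for x
    define q where "q x = (\<Sum>u\<in>V. \<Sum>v\<in>V. x u * X u v * x v)" for x
    \<comment> \<open>the quadratic form of \<open>X\<close> at a vector with entry \<open>t\<close> at \<open>c\<close> and entries \<open>x\<close> on \<open>V\<close>\<close>
    have quad: "0 \<le> t\<^sup>2 * X c c + 2 * t * l x + q x" for t x
    proof -
      define y where "y v = (if v = c then t else x v)" for v
      have yc: "y c = t" and yV: "\<And>v. v \<in> V \<Longrightarrow> y v = x v"
        using insert.hyps by (auto simp: y_def)
      have "(\<Sum>u\<in>insert c V. \<Sum>v\<in>insert c V. y u * X u v * y v)
          = t * X c c * t + (\<Sum>v\<in>V. t * X c v * x v) + (\<Sum>u\<in>V. x u * X u c * t + (\<Sum>v\<in>V. x u * X u v * x v))"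
        using insert.hyps by (simp add: yc yV)
      also have "(\<Sum>v\<in>V. t * X c v * x v) = t * l x"
        by (simp add: l_def sum_distrib_left mult_ac)
      also have "(\<Sum>u\<in>V. x u * X u c * t + (\<Sum>v\<in>V. x u * X u v * x v)) = t * l x + q x"
        by (simp add: l_def q_def sum.distrib sum_distrib_left mult_ac sym[of c])
      finally show ?thesis
        using psd_quadratic[OF insert.prems, of y] by (simp add: power2_eq_square algebra_simps)
    qed
    have d0: "0 \<le> X c c"
      using quad[of 1 "\<lambda>_. 0"] by (simp add: l_def q_def)
    have zero: "l x = 0" if "X c c = 0" for x
    proof (rule ccontr)
      assume "l x \<noteq> 0"
      with quad[of "- (q x + 1) / (2 * l x)" x] that show False by (simp add: field_simps)
    qed
    have l_at: "l (\<lambda>w. if w = v then 1 else 0) = X c v" if "v \<in> V" for v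
    proof -
      have "l (\<lambda>w. if w = v then 1 else 0) = (\<Sum>w\<in>V. if w = v then X c w else 0)"
        unfolding l_def by (intro sum.cong) auto
      then show ?thesis using that insert.hyps by (simp add: sum.delta)
    qed
    define Y where "Y u v = X u v - X c u * X c v / X c c" for u v
    have "psd V Y"
      unfolding psd_def
    proof (intro conjI ballI allI)
      fix x :: "'a \<Rightarrow> real"
      have "(\<Sum>u\<in>V. \<Sum>v\<in>V. x u * Y u v * x v)
          = q x - (\<Sum>u\<in>V. \<Sum>v\<in>V. (X c u * x u) * (X c v * x v)) / X c c"
        by (simp add: Y_def q_def sum_subtractf sum_divide_distrib right_diff_distrib left_diff_distrib mult_ac)
      also have "(\<Sum>u\<in>V. \<Sum>v\<in>V. (X c u * x u) * (X c v * x v)) = (l x)\<^sup>2"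
        by (simp add: l_def power2_eq_square sum_product)
      also have "0 \<le> q x - (l x)\<^sup>2 / X c c"
      proof (cases "X c c = 0")
        case True
        with quad[of 0 x] show ?thesis by simp
      next
        case False
        with quad[of "- l x / X c c" x] show ?thesis
          by (simp add: power2_eq_square field_simps)
      qed
      finally show "0 \<le> (\<Sum>u\<in>V. \<Sum>v\<in>V. x u * Y u v * x v)" .
    qed (auto simp: Y_def sym)
    then obtain F where F: "\<And>u v. u \<in> V \<Longrightarrow> v \<in> V \<Longrightarrow> Y u v = (\<Sum>k\<in>V. F k u * F k v)"
      using insert.IH[of Y] by blast
    define G where "G k u = (if k = c then X c u / sqrt (X c c) else if u = c then 0 else F k u)" for k u
    have cc: "X c u * X c c / X c c = X c u" if "u \<in> insert c V" for u
    proof (cases "X c c = 0")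
      case True
      then show ?thesis using that zero l_at[of u] by (cases "u = c") auto
    qed simp
    have s: "sqrt (X c c) * sqrt (X c c) = X c c" using d0 by simp
    have "X u v = (\<Sum>k\<in>insert c V. G k u * G k v)" if "u \<in> insert c V" "v \<in> insert c V" for u v
    proof -
      have "(\<Sum>k\<in>insert c V. G k u * G k v) = G c u * G c v + (\<Sum>k\<in>V. G k u * G k v)"
        using insert.hyps by simp
      also have "G c u * G c v = X c u * X c v / X c c"
        using d0 by (simp add: G_def)
      also have "(\<Sum>k\<in>V. G k u * G k v) = (if u = c \<or> v = c then 0 else Y u v)"
      proof (cases "u = c \<or> v = c")
        case True
        then show ?thesis using insert.hyps by (auto simp: G_def intro!: sum.neutral)
      next
        case False
        have "(\<Sum>k\<in>V. G k u * G k v) = (\<Sum>k\<in>V. F k u * F k v)"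
          using False insert.hyps by (intro sum.cong) (auto simp: G_def)
        then show ?thesis using False that by (auto simp: F)
      qed
      finally show ?thesis
        using cc[of u] cc[of v] that sym[of u c] by (auto simp: Y_def mult.commute)
    qed
    then show ?case by blast
  qed simp
  then show thesis using that by blast
qed

lemma frob_nested: "frob V X Y = (\<Sum>u\<in>V. \<Sum>v\<in>V. X u v * Y u v)"
  by (simp add: frob_def sum.cartesian_product)

text \<open>If the second matrix is a sum of matrices \<open>F k u * F k v\<close>, the inner product is a sum of values of the
quadratic form of the first.\<close>
lemma frob_psd_nonneg:
  assumes "finite V" "psd V X" "psd V Y"
  shows "0 \<le> frob V X Y"
proof -
  obtain F where F: "\<And>u v. u \<in> V \<Longrightarrow> v \<in> V \<Longrightarrow> Y u v = (\<Sum>k\<in>V. F k u * F k v)"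
    using psd_gram[OF assms(1,3)] by blast
  have "frob V X Y = (\<Sum>u\<in>V. \<Sum>v\<in>V. \<Sum>k\<in>V. F k u * X u v * F k v)"
    unfolding frob_nested
    by (intro sum.cong refl) (simp add: F sum_distrib_left mult_ac)
  also have "\<dots> = (\<Sum>u\<in>V. \<Sum>k\<in>V. \<Sum>v\<in>V. F k u * X u v * F k v)"
    by (rule sum.cong, rule refl, rule sum.swap)
  also have "\<dots> = (\<Sum>k\<in>V. \<Sum>u\<in>V. \<Sum>v\<in>V. F k u * X u v * F k v)"
    by (rule sum.swap)
  finally show ?thesis using psd_quadratic[OF assms(2)] by (simp add: sum_nonneg)
qed

text \<open>Schur's product theorem. The quadratic form of the entrywise product at \<open>x\<close> is the inner product of the first
matrix with the second one rescaled by \<open>x\<close>.\<close>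
lemma psd_hadamard:
  assumes "finite V" "psd V X" "psd V Y"
  shows "psd V (\<lambda>u v. X u v * Y u v)"
  unfolding psd_def
proof (intro conjI ballI allI)
  fix x :: "'a \<Rightarrow> real"
  obtain F where F: "\<And>u v. u \<in> V \<Longrightarrow> v \<in> V \<Longrightarrow> Y u v = (\<Sum>k\<in>V. F k u * F k v)"
    using psd_gram[OF assms(1,3)] by blast
  have "psd V (\<lambda>u v. x u * Y u v * x v)"
    by (rule psd_gram_imp[OF assms(1), where K = V and F = "\<lambda>k u. x u * F k u"])
      (simp add: F sum_distrib_left sum_distrib_right mult_ac)
  from frob_psd_nonneg[OF assms(1,2) this]
  show "0 \<le> (\<Sum>u\<in>V. \<Sum>v\<in>V. x u * (X u v * Y u v) * x v)"
    by (simp add: frob_nested mult_ac)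
qed (use assms in \<open>auto simp: psd_def\<close>)

lemma psd_pullback:
  assumes "finite V" "finite K" "psd K S" "\<And>u. u \<in> V \<Longrightarrow> r u \<in> K"
  shows "psd V (\<lambda>u v. S (r u) (r v))"
proof -
  obtain F where F: "\<And>i j. i \<in> K \<Longrightarrow> j \<in> K \<Longrightarrow> S i j = (\<Sum>k\<in>K. F k i * F k j)"
    using psd_gram[OF assms(2,3)] by blast
  show ?thesis
    by (rule psd_gram_imp[OF assms(1), where K = K and F = "\<lambda>k u. F k (r u)"]) (simp add: F assms(4))
qed

lemma psd_one: "finite V \<Longrightarrow> psd V (\<lambda>_ _. 1)"
  by (rule psd_gram_imp[where K = "{()}" and F = "\<lambda>_ _. 1"]) auto

lemma psd_prod:
  assumes "finite V" "finite J" "\<And>j. j \<in> J \<Longrightarrow> psd V (M j)"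
  shows "psd V (\<lambda>u v. \<Prod>j\<in>J. M j u v)"
  using assms(2,3)
proof (induction J rule: finite_induct)
  case empty
  then show ?case using psd_one[OF assms(1)] by simp
next
  case (insert j J)
  then show ?case using psd_hadamard[OF assms(1), of "M j" "\<lambda>u v. \<Prod>j\<in>J. M j u v"] by simp
qed

lemma psd_add: "psd V X \<Longrightarrow> psd V Y \<Longrightarrow> psd V (\<lambda>u v. X u v + Y u v)"
  by (auto simp: psd_def algebra_simps sum.distrib)

lemma psd_scale:
  assumes "psd V X" "0 \<le> t"
  shows "psd V (\<lambda>u v. t * X u v)"
  unfolding psd_def
proof (intro conjI ballI allI)
  fix x :: "'a \<Rightarrow> real"
  have "(\<Sum>u\<in>V. \<Sum>v\<in>V. x u * (t * X u v) * x v) = t * (\<Sum>u\<in>V. \<Sum>v\<in>V. x u * X u v * x v)"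
    by (simp add: sum_distrib_left mult_ac)
  then show "0 \<le> (\<Sum>u\<in>V. \<Sum>v\<in>V. x u * (t * X u v) * x v)"
    using psd_quadratic[OF assms(1)] assms(2) by simp
qed (use assms in \<open>auto simp: psd_def\<close>)

text \<open>The Gram matrix of the vertices of a regular simplex with \<open>c\<close> vertices.\<close>
lemma psd_simplex:
  assumes "2 \<le> c"
  shows "psd {..<c} (\<lambda>i j. if i = j then 1 else - 1 / (real c - 1))"
  unfolding psd_def
proof (intro conjI ballI allI)
  fix x :: "nat \<Rightarrow> real"
  define k where "k = 1 / (real c - 1)"
  have k: "1 + k = real c * k" "0 \<le> k" using assms by (auto simp: k_def field_simps)
  have "(\<Sum>i<c. \<Sum>j<c. x i * (if i = j then 1 else - 1 / (real c - 1)) * x j)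
     = (\<Sum>i<c. \<Sum>j<c. (if i = j then (1 + k) * (x i)\<^sup>2 else 0) - k * (x i * x j))"
    by (intro sum.cong refl) (simp add: k_def algebra_simps power2_eq_square)
  also have "\<dots> = (1 + k) * (\<Sum>i<c. (x i)\<^sup>2) - k * (\<Sum>i<c. x i)\<^sup>2"
    unfolding power2_eq_square[of "sum x {..<c}"] sum_product
    by (simp add: sum_subtractf sum_distrib_left)
  also have "\<dots> = k * (real c * (\<Sum>i<c. (x i)\<^sup>2) - (\<Sum>i<c. x i)\<^sup>2)"
    by (simp add: k algebra_simps)
  also have "\<dots> \<ge> 0"
    using Cauchy_Schwarz_ineq_sum[of "\<lambda>_. 1" x "{..<c}"] k by simp
  finally show "0 \<le> (\<Sum>i<c. \<Sum>j<c. x i * (if i = j then 1 else - 1 / (real c - 1)) * x j)" .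
qed auto

lemma frob_add_left: "frob V (\<lambda>u v. X u v + Y u v) Z = frob V X Z + frob V Y Z"
  by (simp add: frob_def sum.distrib distrib_right split_def)

lemma frob_commute: "frob V X Y = frob V Y X"
  by (simp add: frob_def mult.commute)

lemma frob_self: "frob V X X = (\<Sum>(u, v)\<in>V \<times> V. (X u v)\<^sup>2)"
  by (simp add: frob_def power2_eq_square)

lemma frob_self_nonneg: "0 \<le> frob V X X"
  by (auto simp: frob_self intro: sum_nonneg)

lemma frob_self_perturb:
  "frob V (\<lambda>u v. X u v + t * Y u v) (\<lambda>u v. X u v + t * Y u v) =
   frob V X X + 2 * t * frob V X Y + t\<^sup>2 * frob V Y Y"
  by (simp add: frob_def sum.distrib sum_distrib_left split_def power2_eq_square distrib_left distrib_right mult_ac)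

section \<open>Trees of blocks\<close>

text \<open>Vertex sets are left out of the locale: blocks and their unions are just sets of vertices, and \<open>E\<close> is restricted
to them.\<close>
locale simple_graph =
  fixes E :: "'a \<Rightarrow> 'a \<Rightarrow> bool"
  assumes E_sym: "E u v \<Longrightarrow> E v u" and E_irrefl: "\<not> E u u"
begin

definition arcs_in :: "'a set \<Rightarrow> ('a \<times> 'a) set" where
  "arcs_in W = {(u, v). u \<in> W \<and> v \<in> W \<and> E u v}"

text \<open>Connectedness as the absence of an empty cut, the form in which it is used below.\<close>
definition connected_on :: "'a set \<Rightarrow> bool" where
  "connected_on W \<longleftrightarrow> (\<forall>S\<subseteq>W. S \<noteq> {} \<longrightarrow> S \<noteq> W \<longrightarrow> (\<exists>u\<in>S. \<exists>v\<in>W - S. E u v))"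

definition block_matrix :: "'a set \<Rightarrow> 'a \<Rightarrow> 'a \<Rightarrow> real" where
  "block_matrix W u v = (if (u, v) \<in> arcs_in W then 1 else 0)"

definition adj :: "'a set set \<Rightarrow> ('a set \<Rightarrow> real) \<Rightarrow> 'a \<Rightarrow> 'a \<Rightarrow> real" where
  "adj \<W> a u v = (\<Sum>W\<in>\<W>. a W * block_matrix W u v)"

text \<open>The sum of the squared weights over the edges of a spanning tree: all of them contain
\<open>card W - 1\<close> edges of the block \<open>W\<close>.\<close>
definition tree_weight :: "'a set set \<Rightarrow> ('a set \<Rightarrow> real) \<Rightarrow> real" where
  "tree_weight \<W> a = (\<Sum>W\<in>\<W>. (a W)\<^sup>2 * (real (card W) - 1))"

text \<open>In a tree of blocks the graph falls into \<open>card W\<close> branches when the edges of \<open>W\<close> are removed, one at each vertex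
of \<open>W\<close>. The map \<open>r\<close> sends a vertex to the vertex of \<open>W\<close> that its branch hangs from. Any other
block lies within one branch.\<close>
definition branch_map :: "'a set \<Rightarrow> 'a set set \<Rightarrow> 'a set \<Rightarrow> ('a \<Rightarrow> 'a) \<Rightarrow> bool" where
  "branch_map V \<W> W r \<longleftrightarrow> r ` V \<subseteq> W \<and> (\<forall>u\<in>W. r u = u) \<and> (\<forall>U\<in>\<W> - {W}. \<forall>x\<in>U. \<forall>y\<in>U. r x = r y)"

text \<open>The existence of the branch maps is all that is required of a tree of blocks: it says that there are no cycles of
blocks, and it passes at once to subgraphs.\<close>
definition block_tree :: "'a set \<Rightarrow> 'a set set \<Rightarrow> bool" where
  "block_tree V \<W> \<longleftrightarrow> finite V \<and>
     (\<forall>W\<in>\<W>. W \<subseteq> V \<and> 2 \<le> card W \<and> connected_on W \<and> (\<exists>r. branch_map V \<W> W r))"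

definition shifted_energy :: "'a set \<Rightarrow> 'a set set \<Rightarrow> ('a set \<Rightarrow> real) \<Rightarrow> ('a \<Rightarrow> 'a \<Rightarrow> real) \<Rightarrow> real" where
  "shifted_energy V \<W> a X = frob V (\<lambda>u v. adj \<W> a u v + X u v) (\<lambda>u v. adj \<W> a u v + X u v)"

definition energy_bound :: "'a set \<Rightarrow> 'a set set \<Rightarrow> bool" where
  "energy_bound V \<W> \<longleftrightarrow> (\<forall>a X. psd V X \<longrightarrow>
     tree_weight \<W> a \<le> shifted_energy V \<W> a X)"

lemma branch_mapI:
  assumes "\<And>u. u \<in> V \<Longrightarrow> r u \<in> W" "\<And>u. u \<in> W \<Longrightarrow> r u = u"
    "\<And>U x y. U \<in> \<W> \<Longrightarrow> U \<noteq> W \<Longrightarrow> x \<in> U \<Longrightarrow> y \<in> U \<Longrightarrow> r x = r y"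
  shows "branch_map V \<W> W r"
  unfolding branch_map_def using assms by blast

lemma branch_mapD:
  assumes "branch_map V \<W> W r"
  shows "u \<in> V \<Longrightarrow> r u \<in> W" "u \<in> W \<Longrightarrow> r u = u"
    "U \<in> \<W> \<Longrightarrow> U \<noteq> W \<Longrightarrow> x \<in> U \<Longrightarrow> y \<in> U \<Longrightarrow> r x = r y"
  using assms unfolding branch_map_def by blast+

lemma block_tree_finite:
  assumes "block_tree V \<W>"
  shows "finite V" "finite \<W>"
proof -
  show "finite V" using assms by (simp add: block_tree_def)
  moreover have "\<W> \<subseteq> Pow V" using assms by (auto simp: block_tree_def)
  ultimately show "finite \<W>" by (meson finite_Pow_iff finite_subset)
qed

lemma block_treeD:
  assumes "block_tree V \<W>" "W \<in> \<W>"
  shows "W \<subseteq> V" "finite W" "2 \<le> card W" "connected_on W" "\<exists>r. branch_map V \<W> W r"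
  using assms by (auto simp: block_tree_def intro: finite_subset)

lemma blocks_meet_in_point:
  assumes "block_tree V \<W>" "W \<in> \<W>" "U \<in> \<W>" "U \<noteq> W" "x \<in> U" "x \<in> W" "y \<in> U" "y \<in> W"
  shows "x = y"
proof -
  obtain r where r: "branch_map V \<W> W r" using block_treeD(5)[OF assms(1,2)] by blast
  have "r x = r y" by (rule branch_mapD(3)[OF r assms(3,4,5,7)])
  then show ?thesis using branch_mapD(2)[OF r] assms(6,8) by simp
qed

lemma arcs_in_disjoint:
  assumes "block_tree V \<W>" "W \<in> \<W>" "U \<in> \<W>" "U \<noteq> W" "p \<in> arcs_in W"
  shows "p \<notin> arcs_in U"
  using blocks_meet_in_point[OF assms(1-4)] assms(5) E_irrefl by (auto simp: arcs_in_def)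

lemma arcs_in_subset: "W \<subseteq> V \<Longrightarrow> arcs_in W \<subseteq> V \<times> V"
  by (auto simp: arcs_in_def)

lemma frob_block_matrix:
  assumes "finite V" "W \<subseteq> V"
  shows "frob V X (block_matrix W) = (\<Sum>(u, v)\<in>arcs_in W. X u v)"
proof -
  have "frob V X (block_matrix W) = (\<Sum>p\<in>V \<times> V. if p \<in> arcs_in W then X (fst p) (snd p) else 0)"
    unfolding frob_def by (intro sum.cong) (auto simp: block_matrix_def)
  also have "\<dots> = (\<Sum>p\<in>(V \<times> V) \<inter> arcs_in W. X (fst p) (snd p))"
    using assms by (intro sum.inter_restrict[symmetric]) auto
  also have "(V \<times> V) \<inter> arcs_in W = arcs_in W" using arcs_in_subset[OF assms(2)] by blast
  finally show ?thesis by (simp add: split_def)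
qed

lemma adj_on_block:
  assumes "block_tree V \<W>" "W \<in> \<W>" "(u, v) \<in> arcs_in W"
  shows "adj \<W> a u v = a W"
proof -
  have "adj \<W> a u v = (\<Sum>U\<in>\<W>. if U = W then a W else 0)"
    unfolding adj_def
    by (intro sum.cong refl) (use arcs_in_disjoint[OF assms(1,2)] assms(3) in \<open>auto simp: block_matrix_def\<close>)
  then show ?thesis using assms(2) block_tree_finite[OF assms(1)] by simp
qed

lemma frob_adj: "frob V X (adj \<W> a) = (\<Sum>W\<in>\<W>. a W * frob V X (block_matrix W))"
  unfolding frob_def adj_def
  by (simp add: sum_distrib_left split_def mult_ac) (rule sum.swap)

lemma frob_adj_block_matrix:
  assumes "block_tree V \<W>" "W \<in> \<W>"
  shows "frob V (adj \<W> a) (block_matrix W) = a W * real (card (arcs_in W))"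
proof -
  have "frob V (adj \<W> a) (block_matrix W) = (\<Sum>(u, v)\<in>arcs_in W. adj \<W> a u v)"
    using frob_block_matrix block_tree_finite(1)[OF assms(1)] block_treeD(1)[OF assms] by blast
  also have "\<dots> = (\<Sum>p\<in>arcs_in W. a W)"
    by (intro sum.cong refl) (auto simp: adj_on_block[OF assms])
  finally show ?thesis by simp
qed

lemma weight_term_nonneg:
  assumes "block_tree V \<W>" "W \<in> \<W>"
  shows "0 \<le> (a W)\<^sup>2 * (real (card W) - 1)"
  using block_treeD(3)[OF assms] by simp

lemma tree_weight_nonneg: "block_tree V \<W> \<Longrightarrow> 0 \<le> tree_weight \<W> a"
  unfolding tree_weight_def by (rule sum_nonneg, rule weight_term_nonneg)

lemma weight_le_tree_weight:
  assumes "block_tree V \<W>" "W \<in> \<W>"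
  shows "(a W)\<^sup>2 * (real (card W) - 1) \<le> tree_weight \<W> a"
  unfolding tree_weight_def
  by (rule member_le_sum[OF assms(2) weight_term_nonneg[OF assms(1)] block_tree_finite(2)[OF assms(1)]]) simp

text \<open>A cut of \<open>insert c S\<close> has one side contained in \<open>S\<close>. Vertices of that side have no neighbours in \<open>W\<close> outside
\<open>insert c S\<close>, so a cut without edges would be one of \<open>W\<close>.\<close>
lemma connected_on_side:
  assumes "connected_on W" "c \<in> W" "S \<subseteq> W - {c}" "\<And>u v. u \<in> S \<Longrightarrow> v \<in> W - {c} - S \<Longrightarrow> \<not> E u v"
  shows "connected_on (insert c S)"
  unfolding connected_on_def
proof (intro allI impI)
  fix U assume U: "U \<subseteq> insert c S" "U \<noteq> {}" "U \<noteq> insert c S"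
  have *: "\<exists>u\<in>U'. \<exists>v\<in>insert c S - U'. E u v" if U': "U' \<subseteq> S" "U' \<noteq> {}" for U'
  proof -
    have "U' \<subseteq> W" "U' \<noteq> W" using U' assms(2,3) by auto
    then obtain u v where "u \<in> U'" "v \<in> W - U'" "E u v"
      using assms(1) U' unfolding connected_on_def by blast
    then show ?thesis using assms(4) U' by blast
  qed
  show "\<exists>u\<in>U. \<exists>v\<in>insert c S - U. E u v"
  proof (cases "c \<in> U")
    case False
    then show ?thesis using *[of U] U by blast
  next
    case True
    then have "insert c S - U \<subseteq> S" "insert c S - U \<noteq> {}" using U by auto
    from *[OF this] obtain u v where "u \<in> insert c S - U" "v \<in> insert c S - (insert c S - U)" "E u v" by blast
    then show ?thesis using U E_sym[of u v] by blast
  qed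
qed

text \<open>After splitting \<open>W\<close> at \<open>c\<close>, what hangs from the second part hangs from \<open>c\<close> as seen from
the first part.\<close>
lemma branch_map_split:
  assumes r: "branch_map V \<W> W r" and W: "W \<subseteq> V" "W1 \<union> W2 = W" "W1 \<inter> W2 = {c}"
  shows "branch_map V (\<W> - {W} \<union> {W1, W2}) W1 (\<lambda>u. if r u \<in> W1 then r u else c)"
proof (rule branch_mapI)
  have c: "c \<in> W1" "\<And>x. x \<in> W1 \<Longrightarrow> x \<in> W2 \<Longrightarrow> x = c" and sub: "\<And>x. x \<in> W1 \<or> x \<in> W2 \<Longrightarrow> x \<in> W"
    using W(2,3) by blast+
  show "(if r u \<in> W1 then r u else c) \<in> W1" for u using c(1) by simp
  show "(if r u \<in> W1 then r u else c) = u" if "u \<in> W1" for u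
    using branch_mapD(2)[OF r, of u] sub[of u] that by simp
  fix U x y assume U: "U \<in> \<W> - {W} \<union> {W1, W2}" "U \<noteq> W1" and xy: "x \<in> U" "y \<in> U"
  show "(if r x \<in> W1 then r x else c) = (if r y \<in> W1 then r y else c)"
  proof (cases "U = W2")
    case True
    have "(if r z \<in> W1 then r z else c) = c" if "z \<in> U" for z
      using branch_mapD(2)[OF r, of z] sub[of z] c(2)[of z] that True by simp
    then show ?thesis using xy by metis
  next
    case False
    then have "U \<in> \<W>" "U \<noteq> W" using U by blast+
    then have "r x = r y" using branch_mapD(3)[OF r] xy by blast
    then show ?thesis by simp
  qed
qed

lemma branch_map_refine:
  assumes "branch_map V \<W> U r" "U \<noteq> W" "W \<in> \<W>" "\<forall>Y\<in>\<W>'. Y \<in> \<W> \<or> Y \<subseteq> W" 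
  shows "branch_map V \<W>' U r"
proof (rule branch_mapI)
  note rD = branch_mapD[OF assms(1)]
  show "r x = r y" if "Y \<in> \<W>'" "Y \<noteq> U" "x \<in> Y" "y \<in> Y" for Y x y
  proof (cases "Y \<in> \<W>")
    case True
    then show ?thesis using rD(3) that by blast
  next
    case False
    then have "x \<in> W" "y \<in> W" using that assms(4) by auto
    then show ?thesis using rD(3)[OF assms(3)] assms(2) by blast
  qed
qed (use branch_mapD[OF assms(1)] in blast)+

lemma split_at_cut_vertex:
  assumes bt: "block_tree V \<W>" and W: "W \<in> \<W>" "c \<in> W" "\<not> connected_on (W - {c})"
  obtains W1 W2 where
    "W1 \<union> W2 = W" "W1 \<inter> W2 = {c}" "W1 \<notin> \<W>" "W2 \<notin> \<W>" "W1 \<noteq> W2" "2 \<le> card W1" "2 \<le> card W2"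
    "card W1 + card W2 = card W + 1" "arcs_in W = arcs_in W1 \<union> arcs_in W2" "arcs_in W1 \<inter> arcs_in W2 = {}"
    "block_tree V (\<W> - {W} \<union> {W1, W2})"
proof -
  note WD = block_treeD[OF bt W(1)]
  obtain S where S: "S \<subseteq> W - {c}" "S \<noteq> {}" "S \<noteq> W - {c}"
    and noedge: "\<And>u v. u \<in> S \<Longrightarrow> v \<in> W - {c} - S \<Longrightarrow> \<not> E u v"
    using W(3) unfolding connected_on_def by blast
  define W1 where "W1 = insert c S"
  define W2 where "W2 = insert c (W - {c} - S)"
  have un: "W1 \<union> W2 = W" and int: "W1 \<inter> W2 = {c}" using S W by (auto simp: W1_def W2_def)
  have fin: "finite W1" "finite W2" using un WD(2) by auto
  have c1: "2 \<le> card W1"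
  proof -
    obtain s where "s \<in> S" using S(2) by blast
    then have "{c, s} \<subseteq> W1" "c \<noteq> s" using S by (auto simp: W1_def)
    then show ?thesis using card_mono[OF fin(1), of "{c,s}"] by simp
  qed
  have c2: "2 \<le> card W2"
  proof -
    obtain s where "s \<in> W - {c} - S" using S by blast
    then have "{c, s} \<subseteq> W2" "c \<noteq> s" using S by (auto simp: W2_def)
    then show ?thesis using card_mono[OF fin(2), of "{c,s}"] by simp
  qed
  have card: "card W1 + card W2 = card W + 1"
    using card_Un_Int[OF fin] un int by simp
  have ne: "W1 \<noteq> W" "W2 \<noteq> W" using card c1 c2 by auto
  have notin: "Y \<notin> \<W>" if "Y \<subseteq> W" "Y \<noteq> W" "2 \<le> card Y" "finite Y" for Y
  proof
    assume "Y \<in> \<W>"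
    then have "\<forall>x\<in>Y. \<forall>y\<in>Y. x = y" using blocks_meet_in_point[OF bt W(1), of Y] that by blast
    then show False using that(3,4) by (auto simp: numeral_2_eq_2 card_le_Suc_iff)
  qed
  have n1: "W1 \<notin> \<W>" and n2: "W2 \<notin> \<W>" using notin[of W1] notin[of W2] ne c1 c2 fin un by auto
  have ne12: "W1 \<noteq> W2" using int c1 by auto
  have arcs: "arcs_in W = arcs_in W1 \<union> arcs_in W2"
  proof -
    have "(u, v) \<in> arcs_in W1 \<union> arcs_in W2" if uv: "u \<in> W" "v \<in> W" "E u v" for u v
      using noedge[of u v] noedge[of v u] E_sym[OF uv(3)] uv unfolding arcs_in_def W1_def W2_def by auto
    then show ?thesis using un by (auto simp: arcs_in_def)
  qed
  have arcs_disj: "arcs_in W1 \<inter> arcs_in W2 = {}"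
  proof (rule equals0I)
    fix p assume p: "p \<in> arcs_in W1 \<inter> arcs_in W2"
    obtain u v where "p = (u, v)" by (cases p)
    then have "u \<in> W1 \<inter> W2" "v \<in> W1 \<inter> W2" "E u v" using p unfolding arcs_in_def by blast+
    then show False using E_irrefl unfolding int by blast
  qed
  have conn1: "connected_on W1" unfolding W1_def by (rule connected_on_side[OF WD(4) W(2) S(1) noedge])
  have conn2: "connected_on W2" unfolding W2_def
  proof (rule connected_on_side[OF WD(4) W(2)])
    fix u v assume "u \<in> W - {c} - S" "v \<in> W - {c} - (W - {c} - S)"
    then show "\<not> E u v" using noedge[of v u] E_sym[of u v] by blast
  qed blast
  obtain r where r: "branch_map V \<W> W r" using WD(5) by blast
  have bt': "block_tree V (\<W> - {W} \<union> {W1, W2})"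
    unfolding block_tree_def
  proof (intro conjI ballI)
    show "finite V" using block_tree_finite[OF bt] by simp
    fix U assume U: "U \<in> \<W> - {W} \<union> {W1, W2}"
    have r1: "branch_map V (\<W> - {W} \<union> {W1, W2}) W1 (\<lambda>u. if r u \<in> W1 then r u else c)"
      by (rule branch_map_split[OF r WD(1) un int])
    have r2: "branch_map V (\<W> - {W} \<union> {W1, W2}) W2 (\<lambda>u. if r u \<in> W2 then r u else c)"
      using branch_map_split[OF r WD(1), of W2 W1] un int by (simp add: Un_commute Int_commute insert_commute)
    from U consider "U = W1" | "U = W2" | "U \<in> \<W>" "U \<noteq> W" by blast
    then have "U \<subseteq> V \<and> 2 \<le> card U \<and> connected_on U \<and> (\<exists>r. branch_map V (\<W> - {W} \<union> {W1, W2}) U r)"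
    proof cases
      case 1
      then show ?thesis using r1 un WD(1) c1 conn1 by blast
    next
      case 2
      then show ?thesis using r2 un WD(1) c2 conn2 by blast
    next
      case 3
      obtain s where "branch_map V \<W> U s" using block_treeD(5)[OF bt 3(1)] by blast
      then have "branch_map V (\<W> - {W} \<union> {W1, W2}) U s"
        by (rule branch_map_refine[OF _ 3(2) W(1)]) (use un in blast)
      then show ?thesis using block_treeD(1,3,4)[OF bt 3(1)] by blast
    qed
    then show "U \<subseteq> V" "2 \<le> card U" "connected_on U" "\<exists>r. branch_map V (\<W> - {W} \<union> {W1, W2}) U r" by simp_all
  qed
  show thesis
    by (rule that[OF un int n1 n2 ne12 c1 c2 card arcs arcs_disj bt'])
qed

text \<open>Splitting a block at a cut vertex is a mere relabelling: when both parts inherit the weight, the matrix is the same, and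
\<open>card W1 + card W2 = card W + 1\<close> keeps the tree weight.\<close>
lemma energy_bound_merge:
  assumes fin: "finite \<W>" and W: "W \<in> \<W>"
    and s: "W1 \<notin> \<W>" "W2 \<notin> \<W>" "W1 \<noteq> W2" "card W1 + card W2 = card W + 1"
      "arcs_in W = arcs_in W1 \<union> arcs_in W2" "arcs_in W1 \<inter> arcs_in W2 = {}"
    and eb: "energy_bound V (\<W> - {W} \<union> {W1, W2})"
  shows "energy_bound V \<W>"
  unfolding energy_bound_def
proof (intro allI impI)
  fix a :: "'a set \<Rightarrow> real" and X assume X: "psd V X"
  define b :: "'a set \<Rightarrow> real" where "b = a(W1 := a W, W2 := a W)"
  have split: "(\<Sum>U\<in>\<W> - {W} \<union> {W1, W2}. f (b U) U) = (\<Sum>U\<in>\<W> - {W}. f (a U) U) + (f (a W) W1 + f (a W) W2)" for f :: "real \<Rightarrow> 'a set \<Rightarrow> real"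
  proof -
    have "(\<Sum>U\<in>\<W> - {W} \<union> {W1, W2}. f (b U) U) = (\<Sum>U\<in>\<W> - {W}. f (b U) U) + (\<Sum>U\<in>{W1, W2}. f (b U) U)"
    proof (rule sum.union_disjoint)
      show "(\<W> - {W}) \<inter> {W1, W2} = {}" using s(1,2) by blast
    qed (use fin in simp_all)
    also have "(\<Sum>U\<in>\<W> - {W}. f (b U) U) = (\<Sum>U\<in>\<W> - {W}. f (a U) U)"
    proof (rule sum.cong[OF refl])
      fix U assume "U \<in> \<W> - {W}"
      then have "U \<noteq> W1" "U \<noteq> W2" using s(1,2) by blast+
      then show "f (b U) U = f (a U) U" by (simp add: b_def)
    qed
    finally show ?thesis using s(3) by (simp add: b_def)
  qed
  have tw: "tree_weight (\<W> - {W} \<union> {W1, W2}) b = tree_weight \<W> a"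
  proof -
    have "real (card W1) + real (card W2) = real (card W) + 1"
      using s(4) by (metis of_nat_add of_nat_1)
    then have "real (card W) - 1 = (real (card W1) - 1) + (real (card W2) - 1)" by simp
    then have "(a W)\<^sup>2 * (real (card W) - 1) = (a W)\<^sup>2 * (real (card W1) - 1) + (a W)\<^sup>2 * (real (card W2) - 1)"
      by (simp only: distrib_left)
    then show ?thesis
      unfolding tree_weight_def split[of "\<lambda>x U. x\<^sup>2 * (real (card U) - 1)"] sum.remove[OF fin W]
      by simp
  qed
  have "adj (\<W> - {W} \<union> {W1, W2}) b u v = adj \<W> a u v" for u v
  proof -
    have "block_matrix W u v = block_matrix W1 u v + block_matrix W2 u v"
      unfolding block_matrix_def s(5) using s(6) by (cases "(u, v) \<in> arcs_in W1"; cases "(u, v) \<in> arcs_in W2") auto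
    then show ?thesis
      unfolding adj_def split[of "\<lambda>x U. x * block_matrix U u v"] sum.remove[OF fin W]
      by (simp add: distrib_left)
  qed
  then show "tree_weight \<W> a \<le> shifted_energy V \<W> a X"
    using eb[unfolded energy_bound_def, rule_format, OF X, of b] tw by (simp add: shifted_energy_def)
qed

text \<open>Deleting a vertex \<open>v\<close> of \<open>W\<close> with its whole branch, rather than \<open>v\<close> alone, leaves a tree of blocks
even when \<open>v\<close> is a cut vertex of the graph. The blocks in the branch disappear and \<open>W\<close> loses one
vertex.\<close>
lemma prune_branch:
  assumes bt: "block_tree V \<W>" and W: "W \<in> \<W>" "3 \<le> card W"
    and r: "branch_map V \<W> W r" and v: "v \<in> W" "connected_on (W - {v})"
  defines "V' \<equiv> {u\<in>V. r u \<noteq> v}" and "\<W>' \<equiv> {U\<in>\<W> - {W}. U \<subseteq> {u\<in>V. r u \<noteq> v}} \<union> {W - {v}}"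
  shows "block_tree V' \<W>'"
    and "W - {v} \<notin> \<W>"
    and "\<And>a x y. x \<in> V' \<Longrightarrow> y \<in> V' \<Longrightarrow> adj \<W>' (a(W - {v} := a W)) x y = adj \<W> a x y"
    and "\<And>a. tree_weight \<W>' (a(W - {v} := a W)) =
      (\<Sum>U | U \<in> \<W> - {W} \<and> U \<subseteq> V'. (a U)\<^sup>2 * (real (card U) - 1)) + (a W)\<^sup>2 * (real (card W) - 2)"
proof -
  note WD = block_treeD[OF bt W(1)]
  have rW: "r u = u" if "u \<in> W" for u using r that by (auto simp: branch_map_def)
  have c: "card (W - {v}) = card W - 1" using v WD by simp
  have fin: "finite V" "finite \<W>" using block_tree_finite[OF bt] by auto
  have sub: "W - {v} \<subseteq> V'" using WD(1) rW by (auto simp: V'_def)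
  show notin: "W - {v} \<notin> \<W>"
  proof
    assume *: "W - {v} \<in> \<W>"
    have "W - {v} \<noteq> W" using v by blast
    then have "\<forall>x\<in>W - {v}. \<forall>y\<in>W - {v}. x = y"
      using blocks_meet_in_point[OF bt W(1) *] by blast
    moreover have "2 \<le> card (W - {v})" using c W by simp
    moreover have "finite (W - {v})" using WD by simp
    ultimately show False by (auto simp: numeral_2_eq_2 card_le_Suc_iff)
  qed
  show "block_tree V' \<W>'"
    unfolding block_tree_def
  proof (intro conjI ballI)
    show "finite V'" using fin by (simp add: V'_def)
    fix U assume "U \<in> \<W>'"
    then consider "U = W - {v}" | "U \<in> \<W>" "U \<noteq> W" "U \<subseteq> V'" unfolding \<W>'_def V'_def by blast
    then have "U \<subseteq> V' \<and> 2 \<le> card U \<and> connected_on U \<and> (\<exists>r. branch_map V' \<W>' U r)"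
    proof cases
      case 1
      have "branch_map V' \<W>' U r"
      proof (rule branch_mapI)
        show "r u \<in> U" if "u \<in> V'" for u using branch_mapD(1)[OF r] that 1 by (auto simp: V'_def)
        show "r u = u" if "u \<in> U" for u using rW that 1 by simp
        show "r x = r y" if "Y \<in> \<W>'" "Y \<noteq> U" "x \<in> Y" "y \<in> Y" for Y x y
        proof -
          have "Y \<in> \<W>" "Y \<noteq> W" using that 1 by (simp_all add: \<W>'_def)
          then show ?thesis using branch_mapD(3)[OF r] that by blast
        qed
      qed
      then show ?thesis using 1 sub c W v by (intro conjI exI) auto
    next
      case 2
      obtain s where "branch_map V \<W> U s" using block_treeD(5)[OF bt 2(1)] by blast
      then have "branch_map V \<W>' U s"
        by (rule branch_map_refine[OF _ 2(2) W(1)]) (unfold \<W>'_def, blast)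
      then have "branch_map V' \<W>' U s" unfolding branch_map_def V'_def by blast
      then show ?thesis using 2 block_treeD(3,4)[OF bt 2(1)] by blast
    qed
    then show "U \<subseteq> V'" "2 \<le> card U" "connected_on U" "\<exists>r. branch_map V' \<W>' U r" by simp_all
  qed
  have split: "(\<Sum>U\<in>\<W>'. f ((a(W - {v} := a W)) U) U) = (\<Sum>U | U \<in> \<W> - {W} \<and> U \<subseteq> V'. f (a U) U) + f (a W) (W - {v})"
    for f :: "real \<Rightarrow> 'a set \<Rightarrow> real" and a
  proof -
    have "(\<Sum>U\<in>\<W>'. f ((a(W - {v} := a W)) U) U) =
        (\<Sum>U | U \<in> \<W> - {W} \<and> U \<subseteq> V'. f ((a(W - {v} := a W)) U) U) + (\<Sum>U\<in>{W - {v}}. f ((a(W - {v} := a W)) U) U)"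
      unfolding \<W>'_def V'_def
    proof (rule sum.union_disjoint)
      show "{U \<in> \<W> - {W}. U \<subseteq> {u \<in> V. r u \<noteq> v}} \<inter> {W - {v}} = {}" using notin by blast
    qed (use fin in simp_all)
    also have "(\<Sum>U | U \<in> \<W> - {W} \<and> U \<subseteq> V'. f ((a(W - {v} := a W)) U) U) = (\<Sum>U | U \<in> \<W> - {W} \<and> U \<subseteq> V'. f (a U) U)"
    proof (rule sum.cong[OF refl])
      fix U assume "U \<in> {U. U \<in> \<W> - {W} \<and> U \<subseteq> V'}"
      then have "U \<noteq> W - {v}" using notin by blast
      then show "f ((a(W - {v} := a W)) U) U = f (a U) U" by simp
    qed
    finally show ?thesis by simp
  qed
  show "tree_weight \<W>' (a(W - {v} := a W)) =
      (\<Sum>U | U \<in> \<W> - {W} \<and> U \<subseteq> V'. (a U)\<^sup>2 * (real (card U) - 1)) + (a W)\<^sup>2 * (real (card W) - 2)" for a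
    unfolding tree_weight_def split[of "\<lambda>x U. x\<^sup>2 * (real (card U) - 1)"]
    using c W by (simp add: of_nat_diff)
  show "adj \<W>' (a(W - {v} := a W)) x y = adj \<W> a x y" if xy: "x \<in> V'" "y \<in> V'" for a x y
  proof -
    have "block_matrix (W - {v}) x y = block_matrix W x y"
      using xy v rW[of v] by (auto simp: block_matrix_def arcs_in_def V'_def)
    moreover have "(\<Sum>U | U \<in> \<W> - {W} \<and> U \<subseteq> V'. a U * block_matrix U x y) = (\<Sum>U\<in>\<W> - {W}. a U * block_matrix U x y)"
    proof (rule sum.mono_neutral_left)
      show "\<forall>U\<in>\<W> - {W} - {U. U \<in> \<W> - {W} \<and> U \<subseteq> V'}. a U * block_matrix U x y = 0"
      proof
        fix U assume U: "U \<in> \<W> - {W} - {U. U \<in> \<W> - {W} \<and> U \<subseteq> V'}"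
        then obtain z where z: "z \<in> U" "z \<notin> V'" by blast
        have "U \<subseteq> V" using U block_treeD(1)[OF bt] by blast
        then have "r z = v" using z by (auto simp: V'_def)
        moreover have "r x = r z" if "x \<in> U" using branch_mapD(3)[OF r _ _ that z(1)] U by blast
ultimately have "x \<notin> U" using xy by (auto simp: V'_def)
        then show "a U * block_matrix U x y = 0" by (simp add: block_matrix_def arcs_in_def)
      qed
    qed (use fin in auto)
    ultimately show ?thesis
      unfolding adj_def split[of "\<lambda>x' U. x' * block_matrix U x y"] sum.remove[OF fin(2) W(1)] by simp
  qed
qed

end

section \<open>Extremal weights\<close>

lemma compact_function_box:
  fixes S :: "'b \<Rightarrow> 'c :: topological_space set"
  assumes "\<And>i. compact (S i)"
  shows "compact {f. \<forall>i. f i \<in> S i}"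
proof -
  have "{f. \<forall>i. f i \<in> S i} = PiE UNIV S" by (auto simp: PiE_def)
  moreover have "compact (PiE UNIV S)"
    using compactin_PiE[of "\<lambda>_. euclidean" UNIV S] assms by (simp add: euclidean_product_topology)
  ultimately show ?thesis by simp
qed

text \<open>First-order condition at a minimum, for a quadratic perturbation in one direction.\<close>
lemma nonneg_if_perturb_nonneg:
  fixes L C :: real
  assumes "\<And>t. 0 \<le> t \<Longrightarrow> t \<le> 1 \<Longrightarrow> 0 \<le> 2 * t * L + t\<^sup>2 * C"
  shows "0 \<le> L"
proof (rule ccontr)
  assume L: "\<not> 0 \<le> L"
  define t where "t = min 1 (- L / (\<bar>C\<bar> + 1))"
  have C1: "0 < \<bar>C\<bar> + 1" by simp
  have "0 < - L / (\<bar>C\<bar> + 1)" using L by (intro divide_pos_pos) auto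
  then have "0 < t" "t \<le> 1" "t \<le> - L / (\<bar>C\<bar> + 1)" by (simp_all add: t_def)
  then have t: "0 < t" "t \<le> 1" "t * (\<bar>C\<bar> + 1) \<le> - L"
    unfolding pos_le_divide_eq[OF C1] by simp_all
  have "t * C \<le> t * (\<bar>C\<bar> + 1)" using t(1) by (intro mult_left_mono) auto
  then have "2 * L + t * C < 0" using t(3) L by linarith
  then have "t * (2 * L + t * C) < 0" by (rule mult_pos_neg[OF t(1)])
  moreover have "t * (2 * L + t * C) = 2 * t * L + t\<^sup>2 * C"
    by (simp add: algebra_simps power2_eq_square)
  ultimately show False using assms[of t] t by simp
qed

context simple_graph
begin

lemma shifted_energy_nonneg: "0 \<le> shifted_energy V \<W> a X"
  by (simp add: shifted_energy_def frob_self_nonneg)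

lemma shifted_energy_scale:
  "shifted_energy V \<W> (\<lambda>U. t * a U) (\<lambda>u v. t * X u v) = t\<^sup>2 * shifted_energy V \<W> a X"
  by (simp add: shifted_energy_def frob_self adj_def split_def sum_distrib_left power_mult_distrib[symmetric] distrib_left mult_ac)

lemma tree_weight_scale: "tree_weight \<W> (\<lambda>U. t * a U) = t\<^sup>2 * tree_weight \<W> a"
  by (simp add: tree_weight_def sum_distrib_left power_mult_distrib mult_ac)

lemma continuous_shifted_energy:
  "continuous_on UNIV (\<lambda>z. shifted_energy V \<W> (fst z) (snd z))"
proof -
  have [continuous_intros]: "continuous_on UNIV (\<lambda>z :: ('a set \<Rightarrow> real) \<times> ('a \<Rightarrow> 'a \<Rightarrow> real). fst z U)" for U
    by (rule continuous_on_product_then_coordinatewise[OF continuous_on_fst[OF continuous_on_id]])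
  have [continuous_intros]: "continuous_on UNIV (\<lambda>z :: ('a set \<Rightarrow> real) \<times> ('a \<Rightarrow> 'a \<Rightarrow> real). snd z u v)" for u v
    by (rule continuous_on_product_then_coordinatewise[OF continuous_on_product_then_coordinatewise[OF continuous_on_snd[OF continuous_on_id]]])
  show ?thesis
    unfolding shifted_energy_def frob_def adj_def split_def by (intro continuous_intros)
qed

lemma closed_feasible:
  "closed {z :: ('a set \<Rightarrow> real) \<times> ('a \<Rightarrow> 'a \<Rightarrow> real). tree_weight \<W> (fst z) = 1 \<and> psd V (snd z)}"
proof -
  have [continuous_intros]: "continuous_on UNIV (\<lambda>z :: ('a set \<Rightarrow> real) \<times> ('a \<Rightarrow> 'a \<Rightarrow> real). fst z U)" for U
    by (rule continuous_on_product_then_coordinatewise[OF continuous_on_fst[OF continuous_on_id]])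
  have [continuous_intros]: "continuous_on UNIV (\<lambda>z :: ('a set \<Rightarrow> real) \<times> ('a \<Rightarrow> 'a \<Rightarrow> real). snd z u v)" for u v
    by (rule continuous_on_product_then_coordinatewise[OF continuous_on_product_then_coordinatewise[OF continuous_on_snd[OF continuous_on_id]]])
  show ?thesis
    unfolding tree_weight_def psd_def Ball_def
    by (intro closed_Collect_conj closed_Collect_all closed_Collect_imp open_Collect_const
        closed_Collect_eq closed_Collect_le continuous_intros)
qed

text \<open>Tree weight \<open>1\<close> bounds the weights, and energy at most \<open>1\<close> then bounds \<open>X\<close>. Entries that
neither quantity reads are set to zero, in order to reach the compact box over all indices.\<close>
lemma normalise_to_box:
  assumes bt: "block_tree V \<W>" and X: "psd V X" and tw: "tree_weight \<W> a = 1"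
    and le: "shifted_energy V \<W> a X \<le> 1"
  defines "R \<equiv> 1 + real (card \<W>)"
  obtains b Y where "psd V Y" "tree_weight \<W> b = 1" "shifted_energy V \<W> b Y = shifted_energy V \<W> a X"
    "\<And>U. b U \<in> {-1..1}" "\<And>u v. Y u v \<in> {-R..R}"
proof -
  define b where "b U = (if U \<in> \<W> then a U else 0)" for U
  define Y where "Y u v = (if u \<in> V \<and> v \<in> V then X u v else 0)" for u v
  have adj: "adj \<W> b u v = adj \<W> a u v" for u v by (simp add: adj_def b_def)
  have a1: "\<bar>a U\<bar> \<le> 1" if "U \<in> \<W>" for U
  proof -
    have "(a U)\<^sup>2 * 1 \<le> (a U)\<^sup>2 * (real (card U) - 1)"
      using block_treeD(3)[OF bt that] by (intro mult_left_mono) auto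
    also have "\<dots> \<le> 1" using weight_le_tree_weight[OF bt that, of a] tw by simp
    finally show ?thesis by (simp add: abs_square_le_1)
  qed
  have ad: "\<bar>adj \<W> a u v\<bar> \<le> real (card \<W>)" for u v
  proof -
    have "\<bar>adj \<W> a u v\<bar> \<le> (\<Sum>U\<in>\<W>. \<bar>a U * block_matrix U u v\<bar>)" unfolding adj_def by (rule sum_abs)
    also have "\<dots> \<le> (\<Sum>U\<in>\<W>. 1)" by (intro sum_mono) (use a1 in \<open>auto simp: block_matrix_def\<close>)
    finally show ?thesis by simp
  qed
  have X1: "\<bar>X u v\<bar> \<le> R" if "u \<in> V" "v \<in> V" for u v
  proof -
    have "(case (u, v) of (u, v) \<Rightarrow> (adj \<W> a u v + X u v)\<^sup>2) \<le> (\<Sum>(u, v)\<in>V \<times> V. (adj \<W> a u v + X u v)\<^sup>2)"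
      by (rule member_le_sum) (use that block_tree_finite[OF bt] in auto)
    also have "\<dots> \<le> 1" using le by (simp add: shifted_energy_def frob_self)
    finally have "\<bar>adj \<W> a u v + X u v\<bar> \<le> 1" by (simp add: abs_square_le_1)
    then show ?thesis using ad[of u v] unfolding R_def by linarith
  qed
  show thesis
  proof (rule that[of Y b])
    show "psd V Y" using X unfolding psd_def Y_def by (simp cong: sum.cong)
    show "tree_weight \<W> b = 1" using tw by (simp add: tree_weight_def b_def)
    show "shifted_energy V \<W> b Y = shifted_energy V \<W> a X"
      unfolding shifted_energy_def frob_def adj by (intro sum.cong refl) (auto simp: Y_def)
    show "b U \<in> {-1..1}" for U using a1[of U] by (auto simp: b_def)
    show "Y u v \<in> {-R..R}" for u v using X1[of u v] by (auto simp: Y_def R_def)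
  qed
qed

text \<open>The minimum is taken over tree weight \<open>1\<close> and stated without this normalisation, so that weights can be varied
freely. Scaling is possible since energy and tree weight are both homogeneous of degree two.\<close>
lemma extremal_weights_exist:
  assumes bt: "block_tree V \<W>" and neg: "\<not> energy_bound V \<W>"
  obtains a X where "psd V X" "tree_weight \<W> a = 1" "shifted_energy V \<W> a X < 1"
    "\<And>b Y. psd V Y \<Longrightarrow> shifted_energy V \<W> a X * tree_weight \<W> b \<le> shifted_energy V \<W> b Y"
proof -
  define R where "R = 1 + real (card \<W>)"
  define C where "C = {z. tree_weight \<W> (fst z) = 1 \<and> psd V (snd z)} \<inter>
    ({b. \<forall>U. b U \<in> {-1..1}} \<times> {Y. \<forall>u. Y u \<in> {y. \<forall>v. y v \<in> {-R..R}}})"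
  have C: "(b, Y) \<in> C \<longleftrightarrow> tree_weight \<W> b = 1 \<and> psd V Y \<and> (\<forall>U. b U \<in> {-1..1}) \<and> (\<forall>u v. Y u v \<in> {-R..R})" for b Y
    by (auto simp: C_def)
  have comp: "compact C"
    unfolding C_def
    by (intro closed_Int_compact closed_feasible compact_Times compact_function_box compact_Icc)
  have scaled: "\<exists>b' Y'. psd V Y' \<and> tree_weight \<W> b' = 1 \<and> shifted_energy V \<W> b' Y' = shifted_energy V \<W> b Y / tree_weight \<W> b"
    if "psd V Y" "0 < tree_weight \<W> b" for b Y
  proof (intro exI conjI)
    let ?t = "1 / sqrt (tree_weight \<W> b)"
    show "psd V (\<lambda>u v. ?t * Y u v)" using that by (intro psd_scale) auto
    show "tree_weight \<W> (\<lambda>U. ?t * b U) = 1"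
      unfolding tree_weight_scale using that by (simp add: power_divide)
    show "shifted_energy V \<W> (\<lambda>U. ?t * b U) (\<lambda>u v. ?t * Y u v) = shifted_energy V \<W> b Y / tree_weight \<W> b"
      unfolding shifted_energy_scale using that by (simp add: power_divide)
  qed
  obtain b0 Y0 where 0: "psd V Y0" "shifted_energy V \<W> b0 Y0 < tree_weight \<W> b0"
    using neg by (auto simp: energy_bound_def not_le)
  have pos: "0 < tree_weight \<W> b0" using 0 shifted_energy_nonneg[of V \<W> b0 Y0] by linarith
  obtain b1 Y1 where 1: "psd V Y1" "tree_weight \<W> b1 = 1" "shifted_energy V \<W> b1 Y1 < 1"
    using scaled[OF 0(1) pos] 0(2) pos by (metis divide_less_eq_1_pos)
  obtain b2 Y2 where 2: "(b2, Y2) \<in> C" "shifted_energy V \<W> b2 Y2 < 1"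
    using normalise_to_box[OF bt 1(1,2) less_imp_le[OF 1(3)]] 1(3) unfolding C R_def by metis
  then have "C \<noteq> {}" by blast
  from continuous_attains_inf[OF comp this continuous_on_subset[OF continuous_shifted_energy subset_UNIV]]
  obtain z where z: "z \<in> C" "\<And>y. y \<in> C \<Longrightarrow> shifted_energy V \<W> (fst z) (snd z) \<le> shifted_energy V \<W> (fst y) (snd y)"
    by blast
  define a where "a = fst z" define X where "X = snd z"
  have aX: "(a, X) \<in> C" using z(1) by (simp add: a_def X_def)
  have min: "shifted_energy V \<W> a X \<le> shifted_energy V \<W> b Y" if "(b, Y) \<in> C" for b Y
    using z(2)[OF that] by (simp add: a_def X_def)
  have lt1: "shifted_energy V \<W> a X < 1" using min[OF 2(1)] 2(2) by linarith
  show thesis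
  proof (rule that[of X a])
    show "psd V X" "tree_weight \<W> a = 1" "shifted_energy V \<W> a X < 1" using aX lt1 by (auto simp: C)
    fix b Y assume Y: "psd V Y"
    show "shifted_energy V \<W> a X * tree_weight \<W> b \<le> shifted_energy V \<W> b Y"
    proof (cases "tree_weight \<W> b = 0")
      case True
      then show ?thesis using shifted_energy_nonneg by simp
    next
      case False
      then have pos: "0 < tree_weight \<W> b" using tree_weight_nonneg[OF bt, of b] by linarith
      obtain b' Y' where s: "psd V Y'" "tree_weight \<W> b' = 1"
        "shifted_energy V \<W> b' Y' = shifted_energy V \<W> b Y / tree_weight \<W> b"
        using scaled[OF Y pos] by blast
      have "shifted_energy V \<W> a X \<le> shifted_energy V \<W> b' Y'"
      proof (cases "shifted_energy V \<W> b' Y' \<le> 1")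
        case True
        obtain b'' Y'' where "(b'', Y'') \<in> C" "shifted_energy V \<W> b'' Y'' = shifted_energy V \<W> b' Y'"
          using normalise_to_box[OF bt s(1,2) True] unfolding C R_def by metis
        then show ?thesis using min by metis
      qed (use lt1 in linarith)
      then show ?thesis using s(3) pos by (simp add: pos_le_divide_eq)
    qed
  qed
qed

end

text \<open>A minimal counterexample in the weights. The whole proof by contradiction takes place here.\<close>
locale extremal_block_tree = simple_graph E for E :: "'a \<Rightarrow> 'a \<Rightarrow> bool" +
  fixes V :: "'a set" and \<W> :: "'a set set" and a :: "'a set \<Rightarrow> real" and X :: "'a \<Rightarrow> 'a \<Rightarrow> real" and \<mu> :: real
  assumes bt: "block_tree V \<W>"
    and X_psd: "psd V X"
    and normalised: "tree_weight \<W> a = 1"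
    and energy_\<mu>: "shifted_energy V \<W> a X = \<mu>"
    and \<mu>_less_1: "\<mu> < 1"
    and minimal: "\<And>b Y. psd V Y \<Longrightarrow> \<mu> * tree_weight \<W> b \<le> shifted_energy V \<W> b Y"
begin

definition P :: "'a \<Rightarrow> 'a \<Rightarrow> real" where
  "P u v = adj \<W> a u v + X u v"

lemma frob_P_P: "frob V P P = \<mu>"
  using energy_\<mu> unfolding shifted_energy_def P_def .

lemma \<mu>_nonneg: "0 \<le> \<mu>"
  using frob_P_P frob_self_nonneg[of V P] by simp

text \<open>Otherwise moving \<open>X\<close> in the direction of \<open>Y\<close> would lower the energy.\<close>
lemma frob_P_psd_nonneg:
  assumes "psd V Y"
  shows "0 \<le> frob V P Y"
proof (rule nonneg_if_perturb_nonneg)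
  fix t :: real assume t: "0 \<le> t" "t \<le> 1"
  have "\<mu> \<le> shifted_energy V \<W> a (\<lambda>u v. X u v + t * Y u v)"
    using minimal[OF psd_add[OF X_psd psd_scale[OF assms t(1)]], of a] normalised by simp
  also have "\<dots> = \<mu> + 2 * t * frob V P Y + t\<^sup>2 * frob V Y Y"
    using frob_self_perturb[of V P t Y] frob_P_P by (simp add: shifted_energy_def P_def add.assoc)
  finally show "0 \<le> 2 * t * frob V P Y + t\<^sup>2 * frob V Y Y" by simp
qed

text \<open>Otherwise rescaling \<open>X\<close> would lower the energy.\<close>
lemma frob_P_X: "frob V P X = 0"
proof -
  have "0 \<le> - frob V P X"
  proof (rule nonneg_if_perturb_nonneg)
    fix t :: real assume t: "0 \<le> t" "t \<le> 1"
    have "psd V (\<lambda>u v. (1 - t) * X u v)" using X_psd t by (intro psd_scale) auto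
    then have "\<mu> \<le> shifted_energy V \<W> a (\<lambda>u v. (1 - t) * X u v)"
      using minimal[of _ a] normalised by fastforce
    also have "\<dots> = frob V (\<lambda>u v. P u v + (- t) * X u v) (\<lambda>u v. P u v + (- t) * X u v)"
      by (simp add: shifted_energy_def P_def algebra_simps)
    also have "\<dots> = \<mu> + 2 * t * (- frob V P X) + t\<^sup>2 * frob V X X"
      unfolding frob_self_perturb frob_P_P by simp
    finally show "0 \<le> 2 * t * (- frob V P X) + t\<^sup>2 * frob V X X" by simp
  qed
  then show ?thesis using frob_P_psd_nonneg[OF X_psd] by simp
qed

text \<open>The condition that the weight of \<open>W\<close> is stationary. Its left side is half the derivative of the
energy and its right side half the derivative of \<open>\<mu>\<close> times the tree weight.\<close>
lemma frob_P_block_matrix: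
  assumes W: "W \<in> \<W>"
  shows "frob V P (block_matrix W) = \<mu> * a W * (real (card W) - 1)"
proof -
  define k where "k = real (card W) - 1"
  have fin: "finite \<W>" using block_tree_finite[OF bt] by simp
  have key: "0 \<le> 2 * t * (frob V P (block_matrix W) - \<mu> * a W * k) + t\<^sup>2 * (frob V (block_matrix W) (block_matrix W) - \<mu> * k)" for t
  proof -
    define b where "b = a(W := a W + t)"
    have adj: "adj \<W> b u v = adj \<W> a u v + t * block_matrix W u v" for u v
      unfolding adj_def sum.remove[OF fin W] by (simp add: b_def distrib_right)
    have tw: "tree_weight \<W> b = 1 + (2 * t * a W + t\<^sup>2) * k"
    proof -
      have "tree_weight \<W> b = tree_weight \<W> a + (2 * t * a W + t\<^sup>2) * k"
        unfolding tree_weight_def sum.remove[OF fin W] by (simp add: b_def k_def power2_eq_square algebra_simps)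
      then show ?thesis using normalised by simp
    qed
    have "shifted_energy V \<W> b X = frob V (\<lambda>u v. P u v + t * block_matrix W u v) (\<lambda>u v. P u v + t * block_matrix W u v)"
      unfolding shifted_energy_def adj P_def by (simp add: add_ac)
    also have "\<dots> = \<mu> + 2 * t * frob V P (block_matrix W) + t\<^sup>2 * frob V (block_matrix W) (block_matrix W)"
      unfolding frob_self_perturb frob_P_P ..
    finally show ?thesis using minimal[OF X_psd, of b] tw by (simp add: algebra_simps)
  qed
  have "0 \<le> frob V P (block_matrix W) - \<mu> * a W * k"
    by (rule nonneg_if_perturb_nonneg[OF key])
  moreover have "0 \<le> - (frob V P (block_matrix W) - \<mu> * a W * k)"
  proof (rule nonneg_if_perturb_nonneg)
    fix t :: real
    show "0 \<le> 2 * t * - (frob V P (block_matrix W) - \<mu> * a W * k) + t\<^sup>2 * (frob V (block_matrix W) (block_matrix W) - \<mu> * k)"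
      using key[of "- t"] by (simp only: power2_minus mult_minus_left mult_minus_right)
  qed
  ultimately show ?thesis by (simp add: k_def)
qed

end

section \<open>Sparse blocks\<close>

context extremal_block_tree
begin

lemma weight_sq_le:
  assumes "W \<in> \<W>"
  shows "(a W)\<^sup>2 * (real (card W) - 1) \<le> 1"
  using weight_le_tree_weight[OF bt assms, of a] normalised by simp

text \<open>Sum the bounds that remain after deleting the branch at each vertex \<open>v\<close> of \<open>W\<close> in turn. An entry of
\<open>P\<close> survives unless one of its two indices lies in the branch deleted, so entries within a branch are counted
\<open>card W - 1\<close> times and entries across branches \<open>card W - 2\<close> times. Every other block is lost only
once, and \<open>W\<close> itself loses one vertex each time.\<close>
lemma cross_branch_energy_le:
  assumes W: "W \<in> \<W>" "3 \<le> card W" "\<And>v. v \<in> W \<Longrightarrow> connected_on (W - {v})"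
    and r: "branch_map V \<W> W r"
    and IH: "\<And>v. v \<in> W \<Longrightarrow> energy_bound {u\<in>V. r u \<noteq> v} ({U\<in>\<W> - {W}. U \<subseteq> {u\<in>V. r u \<noteq> v}} \<union> {W - {v}})"
  shows "(\<Sum>(x, y)\<in>V \<times> V. if r x = r y then 0 else (P x y)\<^sup>2)
    \<le> (a W)\<^sup>2 - (real (card W) - 1) * (1 - \<mu>)"
proof -
  note WD = block_treeD[OF bt W(1)]
  have fin: "finite V" "finite \<W>" using block_tree_finite[OF bt] by auto
  define b where "b = real (card W)"
  define w where "w U = (a U)\<^sup>2 * (real (card U) - 1)" for U
  define V' where "V' v = {u\<in>V. r u \<noteq> v}" for v
  have r_in: "r u \<in> W" if "u \<in> V" for u using branch_mapD(1)[OF r that] .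
  have step: "(\<Sum>U | U \<in> \<W> - {W} \<and> U \<subseteq> V' v. w U) + (a W)\<^sup>2 * (b - 2) \<le> (\<Sum>(x, y)\<in>V' v \<times> V' v. (P x y)\<^sup>2)"
    if v: "v \<in> W" for v
  proof -
    note pr = prune_branch[OF bt W(1,2) r v W(3)[OF v], folded V'_def]
    let ?W' = "{U\<in>\<W> - {W}. U \<subseteq> V' v} \<union> {W - {v}}" and ?a = "a(W - {v} := a W)"
    have "psd (V' v) X" by (rule psd_subset[OF X_psd _ fin(1)]) (simp add: V'_def)
    then have "tree_weight ?W' ?a \<le> frob (V' v) (\<lambda>x y. adj ?W' ?a x y + X x y) (\<lambda>x y. adj ?W' ?a x y + X x y)"
      using IH[OF v, folded V'_def] unfolding energy_bound_def shifted_energy_def by blast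
    also have "\<dots> = (\<Sum>(x, y)\<in>V' v \<times> V' v. (P x y)\<^sup>2)"
      unfolding frob_self
    proof (rule sum.cong[OF refl])
      fix p assume p: "p \<in> V' v \<times> V' v"
      then have "adj ?W' ?a (fst p) (snd p) = adj \<W> a (fst p) (snd p)" by (intro pr(3)) auto
      then show "(case p of (x, y) \<Rightarrow> (adj ?W' ?a x y + X x y)\<^sup>2) = (case p of (x, y) \<Rightarrow> (P x y)\<^sup>2)"
        by (simp only: P_def split_def)
    qed
    finally show ?thesis unfolding pr(4) w_def b_def .
  qed
  have left: "(\<Sum>v\<in>W. \<Sum>(x, y)\<in>V' v \<times> V' v. (P x y)\<^sup>2)
     = (b - 1) * \<mu> - (\<Sum>(x, y)\<in>V \<times> V. if r x = r y then 0 else (P x y)\<^sup>2)"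
  proof -
    have "(\<Sum>v\<in>W. \<Sum>(x, y)\<in>V' v \<times> V' v. (P x y)\<^sup>2)
        = (\<Sum>v\<in>W. \<Sum>p\<in>V \<times> V. if r (fst p) \<noteq> v \<and> r (snd p) \<noteq> v then (P (fst p) (snd p))\<^sup>2 else 0)"
    proof (rule sum.cong[OF refl])
      fix v assume "v \<in> W"
      have "V' v \<times> V' v = {p \<in> V \<times> V. r (fst p) \<noteq> v \<and> r (snd p) \<noteq> v}" by (auto simp: V'_def)
      then show "(\<Sum>(x, y)\<in>V' v \<times> V' v. (P x y)\<^sup>2)
          = (\<Sum>p\<in>V \<times> V. if r (fst p) \<noteq> v \<and> r (snd p) \<noteq> v then (P (fst p) (snd p))\<^sup>2 else 0)"
        using fin by (simp add: sum.inter_filter split_def)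
    qed
    also have "\<dots> = (\<Sum>p\<in>V \<times> V. \<Sum>v\<in>W. if r (fst p) \<noteq> v \<and> r (snd p) \<noteq> v then (P (fst p) (snd p))\<^sup>2 else 0)"
      by (rule sum.swap)
    also have "\<dots> = (\<Sum>p\<in>V \<times> V. (b - 1) * (P (fst p) (snd p))\<^sup>2 - (if r (fst p) = r (snd p) then 0 else (P (fst p) (snd p))\<^sup>2))"
    proof (rule sum.cong[OF refl])
      fix p assume "p \<in> V \<times> V"
      then have in_W: "{r (fst p), r (snd p)} \<subseteq> W" using r_in by auto
      have "(\<Sum>v\<in>W. if r (fst p) \<noteq> v \<and> r (snd p) \<noteq> v then (P (fst p) (snd p))\<^sup>2 else 0)
          = real (card (W - {r (fst p), r (snd p)})) * (P (fst p) (snd p))\<^sup>2"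
      proof -
        have "W - {r (fst p), r (snd p)} = {v \<in> W. r (fst p) \<noteq> v \<and> r (snd p) \<noteq> v}" by auto
        then show ?thesis using WD(2) by (simp add: sum.inter_filter[symmetric])
      qed
      also have "real (card (W - {r (fst p), r (snd p)})) = b - real (card {r (fst p), r (snd p)})"
        using card_Diff_subset[of "{r (fst p), r (snd p)}" W] card_mono[OF WD(2) in_W] in_W
        by (simp add: b_def of_nat_diff)
      also have "real (card {r (fst p), r (snd p)}) = (if r (fst p) = r (snd p) then 1 else 2)" by simp
      also have "(b - (if r (fst p) = r (snd p) then 1 else 2)) * (P (fst p) (snd p))\<^sup>2
          = (b - 1) * (P (fst p) (snd p))\<^sup>2 - (if r (fst p) = r (snd p) then 0 else (P (fst p) (snd p))\<^sup>2)"
        by (simp add: algebra_simps)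
      finally show "(\<Sum>v\<in>W. if r (fst p) \<noteq> v \<and> r (snd p) \<noteq> v then (P (fst p) (snd p))\<^sup>2 else 0)
          = (b - 1) * (P (fst p) (snd p))\<^sup>2 - (if r (fst p) = r (snd p) then 0 else (P (fst p) (snd p))\<^sup>2)" .
    qed
    also have "\<dots> = (b - 1) * (\<Sum>(x, y)\<in>V \<times> V. (P x y)\<^sup>2) - (\<Sum>(x, y)\<in>V \<times> V. if r x = r y then 0 else (P x y)\<^sup>2)"
      by (simp add: sum_subtractf sum_distrib_left split_def)
    finally show ?thesis using frob_P_P by (simp add: frob_self)
  qed
  have right: "(\<Sum>v\<in>W. \<Sum>U | U \<in> \<W> - {W} \<and> U \<subseteq> V' v. w U) = (b - 1) * (1 - w W)"
  proof -
    have "(\<Sum>v\<in>W. \<Sum>U | U \<in> \<W> - {W} \<and> U \<subseteq> V' v. w U) = (\<Sum>v\<in>W. \<Sum>U\<in>\<W> - {W}. if U \<subseteq> V' v then w U else 0)"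
    proof (rule sum.cong[OF refl])
      fix v
      have "{U. U \<in> \<W> - {W} \<and> U \<subseteq> V' v} = {U \<in> \<W> - {W}. U \<subseteq> V' v}" by blast
      then show "(\<Sum>U | U \<in> \<W> - {W} \<and> U \<subseteq> V' v. w U) = (\<Sum>U\<in>\<W> - {W}. if U \<subseteq> V' v then w U else 0)"
        using fin sum.inter_filter[of "\<W> - {W}" w "\<lambda>U. U \<subseteq> V' v"] by simp
    qed
    also have "\<dots> = (\<Sum>U\<in>\<W> - {W}. \<Sum>v\<in>W. if U \<subseteq> V' v then w U else 0)" by (rule sum.swap)
    also have "\<dots> = (\<Sum>U\<in>\<W> - {W}. (b - 1) * w U)"
    proof (rule sum.cong[OF refl])
      fix U assume U: "U \<in> \<W> - {W}"
      then have UD: "U \<subseteq> V" "2 \<le> card U" using block_treeD[OF bt] by blast+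
      then have "U \<noteq> {}" by auto
      then obtain x where x: "x \<in> U" by blast
      have rx: "r x \<in> W" using r_in UD(1) x by blast
      have const: "r y = r x" if "y \<in> U" for y using branch_mapD(3)[OF r _ _ that x] U by blast
      have iff: "U \<subseteq> V' v \<longleftrightarrow> v \<noteq> r x" for v
      proof
        assume "U \<subseteq> V' v"
        then have "x \<in> V' v" using x by (rule subsetD)
        then show "v \<noteq> r x" unfolding V'_def by blast
      next
        assume v: "v \<noteq> r x"
        show "U \<subseteq> V' v"
        proof
          fix y assume y: "y \<in> U"
          then have "y \<in> V" using UD(1) by (rule_tac subsetD)
          then show "y \<in> V' v" unfolding V'_def using const[OF y] v by simp
        qed
      qed
      have "(\<Sum>v\<in>W. if U \<subseteq> V' v then w U else 0) = (\<Sum>v\<in>W. if v = r x then 0 else w U)"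
        unfolding iff by (rule sum.cong) simp_all
      also have "\<dots> = (\<Sum>v\<in>W - {r x}. w U)"
        using sum.remove[OF WD(2) rx, of "\<lambda>v. if v = r x then 0 else w U"] by simp
      finally show "(\<Sum>v\<in>W. if U \<subseteq> V' v then w U else 0) = (b - 1) * w U"
        using rx WD(2,3) by (simp add: b_def of_nat_diff)
    qed
    also have "\<dots> = (b - 1) * (\<Sum>U\<in>\<W> - {W}. w U)" by (simp add: sum_distrib_left)
    also have "(\<Sum>U\<in>\<W> - {W}. w U) = 1 - w W"
      using normalised sum.remove[OF fin(2) W(1), of w] by (simp add: tree_weight_def w_def)
    finally show ?thesis .
  qed
  have "(b - 1) * (1 - w W) + b * ((a W)\<^sup>2 * (b - 2)) \<le> (\<Sum>v\<in>W. \<Sum>(x, y)\<in>V' v \<times> V' v. (P x y)\<^sup>2)"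
  proof -
    have "(\<Sum>v\<in>W. (\<Sum>U | U \<in> \<W> - {W} \<and> U \<subseteq> V' v. w U) + (a W)\<^sup>2 * (b - 2))
        \<le> (\<Sum>v\<in>W. \<Sum>(x, y)\<in>V' v \<times> V' v. (P x y)\<^sup>2)"
      by (rule sum_mono[OF step])
    then show ?thesis unfolding sum.distrib right by (simp add: b_def)
  qed
  then show ?thesis
    unfolding left by (simp add: w_def b_def[symmetric] power2_eq_square algebra_simps)
qed

text \<open>With \<open>c = card W - 1\<close> and \<open>q = (a W)\<^sup>2\<close>, Cauchy-Schwarz on the arcs of \<open>W\<close>, which number at most \<open>c\<^sup>2\<close>,
gives at least \<open>\<mu>\<^sup>2 * q\<close> of energy across branches, and there is at most \<open>q - c * (1 - \<mu>)\<close> of it. Hence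
\<open>c \<le> (1 + \<mu>) * q\<close>, while \<open>c * q \<le> 1\<close> by the normalisation; this is impossible for \<open>c \<ge> 2\<close>. Arcs count
each edge twice.\<close>
lemma no_sparse_block:
  assumes W: "W \<in> \<W>" "3 \<le> card W" "\<And>v. v \<in> W \<Longrightarrow> connected_on (W - {v})"
    and aW: "a W \<noteq> 0"
    and r: "branch_map V \<W> W r"
    and IH: "\<And>v. v \<in> W \<Longrightarrow> energy_bound {u\<in>V. r u \<noteq> v} ({U\<in>\<W> - {W}. U \<subseteq> {u\<in>V. r u \<noteq> v}} \<union> {W - {v}})"
    and sparse: "card (arcs_in W) \<le> (card W - 1)\<^sup>2"
  shows False
proof -
  define c where "c = real (card W) - 1"
  define m where "m = real (card (arcs_in W))"
  define o1 where "o1 = (\<Sum>(x, y)\<in>V \<times> V. if r x = r y then 0 else (P x y)\<^sup>2)"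
  define q where "q = (a W)\<^sup>2"
  have c2: "2 \<le> c" using W(2) by (simp add: c_def)
  have q0: "0 < q" using aW by (simp add: q_def)
  have mc: "m \<le> c\<^sup>2"
  proof -
    have "m \<le> real ((card W - 1)\<^sup>2)" unfolding m_def using sparse by (rule of_nat_mono)
    then show ?thesis using W(2) by (simp add: c_def of_nat_diff)
  qed
  have o1_le: "o1 \<le> q - c * (1 - \<mu>)"
    using cross_branch_energy_le[OF W r IH] by (simp add: o1_def q_def c_def)
  have WD: "W \<subseteq> V" "finite W" using block_treeD[OF bt W(1)] by auto
  have fin: "finite V" using block_tree_finite[OF bt] by simp
  have "(\<mu> * a W * c)\<^sup>2 = (\<Sum>(x, y)\<in>arcs_in W. P x y)\<^sup>2"
    using frob_P_block_matrix[OF W(1)] frob_block_matrix[OF fin WD(1), of P] by (simp add: c_def)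
  also have "\<dots> = (\<Sum>p\<in>arcs_in W. 1 * P (fst p) (snd p))\<^sup>2" by (simp add: split_def)
  also have "\<dots> \<le> m * (\<Sum>p\<in>arcs_in W. (P (fst p) (snd p))\<^sup>2)"
    using Cauchy_Schwarz_ineq_sum[of "\<lambda>_. 1" "\<lambda>p. P (fst p) (snd p)" "arcs_in W"] by (simp add: m_def)
  also have "\<dots> \<le> c\<^sup>2 * o1"
  proof (rule mult_mono[OF mc])
    have "(\<Sum>p\<in>arcs_in W. (P (fst p) (snd p))\<^sup>2) = (\<Sum>p\<in>arcs_in W. if r (fst p) = r (snd p) then 0 else (P (fst p) (snd p))\<^sup>2)"
    proof (rule sum.cong[OF refl])
      fix p assume "p \<in> arcs_in W"
      then have "fst p \<in> W" "snd p \<in> W" "E (fst p) (snd p)" by (auto simp: arcs_in_def)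
      then have "r (fst p) \<noteq> r (snd p)" using branch_mapD(2)[OF r] E_irrefl by metis
      then show "(P (fst p) (snd p))\<^sup>2 = (if r (fst p) = r (snd p) then 0 else (P (fst p) (snd p))\<^sup>2)" by simp
    qed
    also have "\<dots> \<le> (\<Sum>p\<in>V \<times> V. if r (fst p) = r (snd p) then 0 else (P (fst p) (snd p))\<^sup>2)"
      using arcs_in_subset[OF WD(1)] fin by (intro sum_mono2) auto
    finally show "(\<Sum>p\<in>arcs_in W. (P (fst p) (snd p))\<^sup>2) \<le> o1" by (simp add: o1_def split_def)
  qed (auto intro: sum_nonneg)
  finally have "c\<^sup>2 * (\<mu>\<^sup>2 * q) \<le> c\<^sup>2 * o1" by (simp add: q_def power_mult_distrib mult_ac)
  then have "\<mu>\<^sup>2 * q \<le> o1" using c2 by simp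
  with o1_le have "c * (1 - \<mu>) \<le> q * (1 + \<mu>) * (1 - \<mu>)" by (simp add: algebra_simps power2_eq_square)
  then have "c \<le> q * (1 + \<mu>)" using \<mu>_less_1 by (simp add: mult_le_cancel_right)
  also have "\<dots> < q * 2" using q0 \<mu>_less_1 by (intro mult_strict_left_mono) auto
  also have "\<dots> \<le> q * c" using q0 c2 by (intro mult_left_mono) auto
  also have "\<dots> \<le> 1" using weight_sq_le[OF W(1)] by (simp add: q_def c_def)
  finally show False using c2 by simp
qed

end

section \<open>Dense blocks\<close>

text \<open>The final inequality of the dense case. Let \<open>C\<close>, \<open>u\<close> and \<open>w\<close> be the sums of \<open>t\<close>, \<open>t * (1 - z)\<close> and \<open>t * z * k\<close>.
The second factor is at most \<open>u + 2 * w\<close>, and \<open>u * (u + 2 * w) < (C + w)\<^sup>2\<close> as \<open>u < C\<close>. For \<open>z = 0\<close> it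
would be an equality, the situation of trees.\<close>
lemma dense_weights_contradiction:
  fixes t z k :: "'b \<Rightarrow> real"
  assumes J: "finite J" "J \<noteq> {}"
    and t: "\<And>j. j \<in> J \<Longrightarrow> 0 < t j" and z: "\<And>j. j \<in> J \<Longrightarrow> 0 < z j \<and> z j \<le> 1"
    and k: "\<And>j. j \<in> J \<Longrightarrow> 0 \<le> k j \<and> k j \<le> 1"
  shows "(\<Sum>j\<in>J. t j * (1 - z j)) * (\<Sum>j\<in>J. t j * ((1 + z j * k j) * (1 - z j + z j * k j)))
    < (\<Sum>j\<in>J. t j * (1 + z j * k j))\<^sup>2"
proof -
  define C u w where "C = (\<Sum>j\<in>J. t j)" and "u = (\<Sum>j\<in>J. t j * (1 - z j))" and "w = (\<Sum>j\<in>J. t j * (z j * k j))"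
  have u: "0 \<le> u" unfolding u_def by (rule sum_nonneg) (use t z in \<open>simp add: less_imp_le\<close>)
  have w: "0 \<le> w" unfolding w_def by (rule sum_nonneg) (use t z k in \<open>simp add: less_imp_le\<close>)
  have uC: "u < C" unfolding u_def C_def
  proof (rule sum_strict_mono[OF J])
    fix j assume j: "j \<in> J"
    then have "t j * (1 - z j) < t j * 1" using t[OF j] z[OF j] by (intro mult_strict_left_mono) auto
    then show "t j * (1 - z j) < t j" by simp
  qed
  have "(\<Sum>j\<in>J. t j * ((1 + z j * k j) * (1 - z j + z j * k j))) \<le> (\<Sum>j\<in>J. t j * (1 - z j) + 2 * (t j * (z j * k j)))"
  proof (rule sum_mono)
    fix j assume j: "j \<in> J"
    have "0 \<le> (z j)\<^sup>2 * (k j * (1 - k j))" using k[OF j] by simp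
    then have "(1 + z j * k j) * (1 - z j + z j * k j) \<le> (1 - z j) + 2 * (z j * k j)"
      by (simp add: algebra_simps power2_eq_square)
    from mult_left_mono[OF this less_imp_le[OF t[OF j]]]
    show "t j * ((1 + z j * k j) * (1 - z j + z j * k j)) \<le> t j * (1 - z j) + 2 * (t j * (z j * k j))"
      by (simp add: distrib_left)
  qed
  also have "\<dots> = u + 2 * w" by (simp add: u_def w_def sum.distrib sum_distrib_left)
  finally have "u * (\<Sum>j\<in>J. t j * ((1 + z j * k j) * (1 - z j + z j * k j))) \<le> u * (u + 2 * w)"
    using u by (rule mult_left_mono)
  also have "\<dots> < (C + w)\<^sup>2"
  proof -
    have "u * u < C * C" using u uC by (intro mult_strict_mono) auto
    moreover have "u * w \<le> C * w" using uC w by (intro mult_right_mono) auto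
    moreover have "u * (u + 2 * w) = u * u + 2 * (u * w)" "(C + w)\<^sup>2 = C * C + 2 * (C * w) + w * w"
      by (simp_all add: power2_eq_square algebra_simps)
    ultimately show ?thesis using zero_le_square[of w] by linarith
  qed
  also have "C + w = (\<Sum>j\<in>J. t j * (1 + z j * k j))" by (simp add: C_def w_def sum.distrib distrib_left)
  finally show ?thesis by (simp add: u_def)
qed

context simple_graph
begin

definition proper_colouring :: "'a set \<Rightarrow> nat \<Rightarrow> ('a \<Rightarrow> nat) \<Rightarrow> bool" where
  "proper_colouring W c f \<longleftrightarrow> f ` W \<subseteq> {..<c} \<and> (\<forall>(u, v)\<in>arcs_in W. f u \<noteq> f v)"

text \<open>A complete block gets \<open>card W\<close> colours. Any other one has nonadjacent \<open>u\<close> and \<open>w\<close>; giving them the same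
colour saves one, and \<open>card W - 1\<close> colours are few enough by the lower bound on the number of arcs.\<close>
lemma dense_block_colouring:
  assumes W: "finite W" "2 \<le> card W" "connected_on W"
    and dense: "card W = 2 \<or> (card W - 1)\<^sup>2 < card (arcs_in W)"
  obtains c f where "2 \<le> c" "proper_colouring W c f" "c * (card W - 1) \<le> card (arcs_in W)"
proof (cases "\<forall>u\<in>W. \<forall>v\<in>W. u \<noteq> v \<longrightarrow> E u v")
  case True
  obtain f where f: "bij_betw f W {0..<card W}" using ex_bij_betw_finite_nat[OF W(1)] by blast
  have "arcs_in W = W \<times> W - (\<lambda>u. (u, u)) ` W" using True E_irrefl by (auto simp: arcs_in_def)
  moreover have "card ((\<lambda>u. (u, u)) ` W) = card W" by (rule card_image) (simp add: inj_on_def)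
  ultimately have "card (arcs_in W) = card W * card W - card W"
    using W(1) by (subst \<open>arcs_in W = _\<close>, subst card_Diff_subset) (auto simp: card_cartesian_product)
  then have "card W * (card W - 1) \<le> card (arcs_in W)" by (simp add: diff_mult_distrib2)
  moreover have "proper_colouring W (card W) f"
    using f E_irrefl unfolding proper_colouring_def arcs_in_def bij_betw_def inj_on_def by fastforce
  ultimately show thesis using that W(2) by blast
next
  case False
  then obtain u w where uw: "u \<in> W" "w \<in> W" "u \<noteq> w" "\<not> E u w" by blast
  have "3 \<le> card W"
  proof (rule ccontr)
    assume "\<not> 3 \<le> card W"
    then have "card W = 2" using W(2) by simp
    then have Wuw: "W = {u, w}"
      using card_subset_eq[OF W(1), of "{u, w}"] uw by auto
    have "{u} \<subseteq> W" "{u} \<noteq> {}" "{u} \<noteq> W" using uw by auto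
    then obtain x where "x \<in> W - {u}" "E u x" using W(3) unfolding connected_on_def by blast
    then show False using Wuw uw by auto
  qed
  have "finite (W - {w})" "card (W - {w}) = card W - 1" using W uw by auto
  then obtain g where g: "bij_betw g (W - {w}) {0..<card W - 1}"
    using ex_bij_betw_finite_nat by metis
  define f where "f x = (if x = w then g u else g x)" for x
  have g_in: "g x < card W - 1" if "x \<in> W - {w}" for x using g that by (auto simp: bij_betw_def)
  have g_inj: "x = y" if "x \<in> W - {w}" "y \<in> W - {w}" "g x = g y" for x y
    using g that by (auto simp: bij_betw_def inj_on_def)
  have "f x \<noteq> f y" if xy: "x \<in> W" "y \<in> W" "E x y" for x y
  proof
    assume eq: "f x = f y"
    have ne: "x \<noteq> y" using xy E_irrefl by blast
    consider "x = w" | "y = w" | "x \<noteq> w" "y \<noteq> w" by blast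
    then show False
    proof cases
      case 1
      then have "u = y" using eq ne g_inj[of u y] uw xy by (simp add: f_def)
      then show False using 1 uw xy E_sym by blast
    next
      case 2
      then have "x = u" using eq ne g_inj[of x u] uw xy by (simp add: f_def)
      then show False using 2 uw xy by blast
    next
      case 3
      then show False using eq ne g_inj[of x y] xy by (simp add: f_def)
    qed
  qed
  moreover have "f x < card W - 1" if "x \<in> W" for x
    using g_in[of u] g_in[of x] uw that by (simp add: f_def)
  ultimately have "proper_colouring W (card W - 1) f"
    by (auto simp: proper_colouring_def arcs_in_def)
  moreover have "(card W - 1) * (card W - 1) \<le> card (arcs_in W)"
    using dense \<open>3 \<le> card W\<close> by (simp add: power2_eq_square)
  moreover have "2 \<le> card W - 1" using \<open>3 \<le> card W\<close> by simp
  ultimately show thesis using that by blast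
qed

end

context extremal_block_tree
begin

text \<open>Let \<open>Y\<close> be the entrywise product of \<open>X\<close> with the simplex matrix \<open>M\<close> of the colourings. As \<open>Y\<close> is positive
semidefinite, \<open>\<langle>A, Y\<rangle> = \<langle>P, Y\<rangle> - \<langle>X, Y\<rangle> \<le> \<langle>P, Y\<rangle>\<close>, so that \<open>\<langle>A, Y\<rangle>\<^sup>2 \<le> \<mu> * \<parallel>Y\<parallel>\<^sup>2\<close>. The left
side is known exactly, since \<open>M\<close> is constant on the edges of each block. For the right side, the norm of \<open>X\<close> is
known, and \<open>M\<close> shrinks its entries on the edges, where Cauchy-Schwarz guarantees enough of them.
All sums are over the set \<open>J\<close> of blocks with nonzero weight.\<close>
lemma some_block_not_dense:
  assumes col: "\<And>W. W \<in> \<W> \<Longrightarrow> a W \<noteq> 0 \<Longrightarrow>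
    \<exists>c f. 2 \<le> c \<and> proper_colouring W c f \<and> c * (card W - 1) \<le> card (arcs_in W)"
  shows False
proof -
  define J where "J = {W\<in>\<W>. a W \<noteq> 0}"
  have fin: "finite V" "finite \<W>" "finite J" using block_tree_finite[OF bt] by (auto simp: J_def)
  have J_W: "W \<in> \<W>" if "W \<in> J" for W using that by (simp add: J_def)
  have "\<forall>W\<in>J. \<exists>c f. 2 \<le> c \<and> proper_colouring W c f \<and> c * (card W - 1) \<le> card (arcs_in W)"
    using col by (auto simp: J_def)
  then obtain c f where cf: "\<And>W. W \<in> J \<Longrightarrow> 2 \<le> c W" "\<And>W. W \<in> J \<Longrightarrow> proper_colouring W (c W) (f W)"
    "\<And>W. W \<in> J \<Longrightarrow> c W * (card W - 1) \<le> card (arcs_in W)" by metis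
  have "\<forall>W\<in>J. \<exists>r. branch_map V \<W> W r" using block_treeD(5)[OF bt] J_W by blast
  then obtain r where r: "\<And>W. W \<in> J \<Longrightarrow> branch_map V \<W> W (r W)" by metis
  define \<kappa> where "\<kappa> W = 1 / (real (c W) - 1)" for W
  have \<kappa>: "0 \<le> \<kappa> W \<and> \<kappa> W \<le> 1" "\<kappa> W * (real (c W) - 1) = 1" if "W \<in> J" for W
    using cf(1)[OF that] by (auto simp: \<kappa>_def)
  define S where "S W i j = (if i = j then 1 else - 1 / (real (c W) - 1))" for W and i j :: nat
  define h where "h W u = f W (r W u)" for W u
  define M where "M u v = (\<Prod>W\<in>J. S W (h W u) (h W v))" for u v
  have h_in: "h W u \<in> {..<c W}" if "W \<in> J" "u \<in> V" for W u
    using cf(2)[OF that(1)] branch_mapD(1)[OF r[OF that(1)] that(2)] by (auto simp: proper_colouring_def h_def)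
  have "psd V M"
    unfolding M_def
  proof (rule psd_prod[OF fin(1) fin(3)])
    fix W assume W: "W \<in> J"
    have "psd {..<c W} (S W)" using psd_simplex[OF cf(1)[OF W]] by (simp add: S_def[abs_def])
    from psd_pullback[OF fin(1) finite_lessThan this h_in[OF W]]
    show "psd V (\<lambda>u v. S W (h W u) (h W v))" by simp
  qed
  define Y where "Y u v = X u v * M u v" for u v
  have Y_psd: "psd V Y" unfolding Y_def[abs_def] by (rule psd_hadamard[OF fin(1) X_psd \<open>psd V M\<close>])
  have S_le: "\<bar>S W i j\<bar> \<le> 1" if "W \<in> J" for W i j
    using \<kappa>(1)[OF that] by (auto simp: S_def \<kappa>_def)
  have M_le: "(M u v)\<^sup>2 \<le> 1" for u v
  proof -
    have "\<bar>M u v\<bar> = (\<Prod>W\<in>J. \<bar>S W (h W u) (h W v)\<bar>)" unfolding M_def by (rule abs_prod)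
    also have "\<dots> \<le> 1" by (rule prod_le_1) (use S_le in auto)
    finally show ?thesis by (simp add: abs_square_le_1)
  qed
  \<comment> \<open>all other blocks see \<open>u\<close> and \<open>v\<close> in the same branch and contribute a factor \<open>1\<close>\<close>
  have M_arc: "M u v = - \<kappa> W" if W: "W \<in> J" and uv: "(u, v) \<in> arcs_in W" for W u v
  proof -
    have in_W: "u \<in> W" "v \<in> W" using uv by (auto simp: arcs_in_def)
    have "(\<Prod>U\<in>J - {W}. S U (h U u) (h U v)) = 1"
    proof (rule prod.neutral, rule ballI)
      fix U assume U: "U \<in> J - {W}"
      then have "r U u = r U v" using branch_mapD(3)[OF r J_W[OF W] _ in_W] by blast
      then show "S U (h U u) (h U v) = 1" by (simp add: S_def h_def)
    qed
    moreover have "S W (h W u) (h W v) = - \<kappa> W"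
      using branch_mapD(2)[OF r[OF W]] in_W cf(2)[OF W] uv by (auto simp: S_def h_def \<kappa>_def proper_colouring_def)
    ultimately show ?thesis unfolding M_def prod.remove[OF fin(3) W] by simp
  qed
  \<comment> \<open>the share of \<open>W\<close> in \<open>\<langle>P, A\<rangle> = \<mu>\<close> is \<open>s W\<close>; the colouring bounds it by \<open>\<mu> * t W\<close>, so \<open>s W = t W * (1 - z W)\<close> with \<open>z W > 0\<close>\<close>
  define m where "m W = real (card (arcs_in W))" for W
  define q where "q W = (a W)\<^sup>2" for W
  define t where "t W = m W * q W / real (c W)" for W
  define s where "s W = \<mu> * (q W * (real (card W) - 1))" for W
  define z where "z W = 1 - s W / t W" for W
  have W_facts: "0 < q W" "0 < m W" "0 < t W" "0 < z W \<and> z W \<le> 1" "m W * q W = real (c W) * t W" "s W = t W * (1 - z W)"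
    if W: "W \<in> J" for W
  proof -
    note c2 = cf(1)[OF W]
    have card: "2 \<le> card W" using block_treeD(3)[OF bt J_W[OF W]] .
    show q: "0 < q W" using W by (simp add: J_def q_def)
    have cm: "real (c W) * (real (card W) - 1) \<le> m W"
    proof -
      have "real (c W * (card W - 1)) \<le> m W" unfolding m_def by (rule of_nat_mono[OF cf(3)[OF W]])
      then show ?thesis using card by (simp add: of_nat_diff)
    qed
    have "0 < real (c W) * (real (card W) - 1)" using c2 card by simp
    then show m: "0 < m W" using cm by linarith
    show t: "0 < t W" using m q c2 by (simp add: t_def)
    show "m W * q W = real (c W) * t W" using c2 by (simp add: t_def)
    have d: "real (card W) - 1 \<le> m W / real (c W)" using cm c2 by (simp add: pos_le_divide_eq mult.commute)
    have le: "q W * (real (card W) - 1) \<le> t W"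
      using mult_left_mono[OF d less_imp_le[OF q]] by (simp add: t_def mult_ac)
    have "s W \<le> \<mu> * t W" unfolding s_def by (rule mult_left_mono[OF le \<mu>_nonneg])
    also have "\<dots> < 1 * t W" by (rule mult_strict_right_mono[OF \<mu>_less_1 t])
    finally have "s W < t W" by simp
    moreover have "0 \<le> s W" using \<mu>_nonneg q card by (simp add: s_def)
    ultimately show "0 < z W \<and> z W \<le> 1" using t by (simp add: z_def)
    show "s W = t W * (1 - z W)" using t by (simp add: z_def)
  qed
  have P_ind: "a W * frob V P (block_matrix W) = s W" if "W \<in> J" for W
    using frob_P_block_matrix[OF J_W[OF that]] by (simp add: s_def q_def power2_eq_square mult_ac)
  have X_ind: "a W * frob V X (block_matrix W) = s W - m W * q W" if "W \<in> J" for W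
  proof -
    have "frob V P (block_matrix W) = frob V (adj \<W> a) (block_matrix W) + frob V X (block_matrix W)"
      unfolding P_def[abs_def] by (rule frob_add_left)
    then show ?thesis
      using P_ind[OF that] frob_adj_block_matrix[OF bt J_W[OF that], of a]
      by (simp add: m_def q_def power2_eq_square algebra_simps)
  qed
  have adj_J: "frob V Z (adj \<W> a) = (\<Sum>W\<in>J. a W * frob V Z (block_matrix W))" for Z
    unfolding frob_adj by (rule sum.mono_neutral_right) (use fin in \<open>auto simp: J_def\<close>)
  have split_P: "frob V Z P = frob V Z (adj \<W> a) + frob V Z X" for Z
    using frob_add_left[of V "adj \<W> a" X Z] by (simp add: frob_commute P_def[abs_def])
  have \<mu>_eq: "\<mu> = (\<Sum>W\<in>J. t W * (1 - z W))"
    using split_P[of P] frob_P_P frob_P_X adj_J[of P] P_ind W_facts(6) by simp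
  have XX: "frob V X X = (\<Sum>W\<in>J. m W * q W - s W)"
  proof -
    have "frob V X X = - (\<Sum>W\<in>J. a W * frob V X (block_matrix W))"
      using split_P[of X] frob_P_X adj_J[of X] by (simp add: frob_commute)
    also have "\<dots> = (\<Sum>W\<in>J. m W * q W - s W)"
      unfolding sum_negf[symmetric] by (rule sum.cong) (simp_all add: X_ind)
    finally show ?thesis .
  qed
  have in_V: "W \<subseteq> V" if "W \<in> J" for W using block_treeD(1)[OF bt J_W[OF that]] .
  have Y_adj: "frob V Y (adj \<W> a) = (\<Sum>W\<in>J. t W * (1 + z W * \<kappa> W))"
    unfolding adj_J
  proof (rule sum.cong[OF refl])
    fix W assume W: "W \<in> J"
    have "frob V Y (block_matrix W) = (\<Sum>(u, v)\<in>arcs_in W. - \<kappa> W * X u v)"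
      unfolding frob_block_matrix[OF fin(1) in_V[OF W]] by (rule sum.cong) (auto simp: Y_def M_arc[OF W])
    also have "\<dots> = - \<kappa> W * frob V X (block_matrix W)"
      unfolding frob_block_matrix[OF fin(1) in_V[OF W]] by (simp add: sum_distrib_left split_def)
    finally have "a W * frob V Y (block_matrix W) = - \<kappa> W * (a W * frob V X (block_matrix W))" by simp
    also have "\<dots> = \<kappa> W * (real (c W) * t W - t W * (1 - z W))"
      using X_ind[OF W] W_facts(5,6)[OF W] by (simp add: right_diff_distrib)
    also have "\<dots> = t W * (\<kappa> W * (real (c W) - 1) + z W * \<kappa> W)" by (simp add: algebra_simps)
    finally show "a W * frob V Y (block_matrix W) = t W * (1 + z W * \<kappa> W)" using \<kappa>(2)[OF W] by simp
  qed
  have YY: "frob V Y Y \<le> (\<Sum>W\<in>J. t W * ((1 + z W * \<kappa> W) * (1 - z W + z W * \<kappa> W)))"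
  proof -
    have "frob V Y Y \<le> (\<Sum>(u, v)\<in>V \<times> V. (X u v)\<^sup>2 - (\<Sum>W\<in>J. (1 - (\<kappa> W)\<^sup>2) * ((X u v)\<^sup>2 * block_matrix W u v)))"
      unfolding frob_self
    proof (rule sum_mono, clarify)
      fix u v
      show "(Y u v)\<^sup>2 \<le> (X u v)\<^sup>2 - (\<Sum>W\<in>J. (1 - (\<kappa> W)\<^sup>2) * ((X u v)\<^sup>2 * block_matrix W u v))"
      proof (cases "\<exists>W\<in>J. (u, v) \<in> arcs_in W")
        case True
        then obtain W where W: "W \<in> J" "(u, v) \<in> arcs_in W" by blast
        have "(\<Sum>U\<in>J. (1 - (\<kappa> U)\<^sup>2) * ((X u v)\<^sup>2 * block_matrix U u v)) = (\<Sum>U\<in>J. if U = W then (1 - (\<kappa> W)\<^sup>2) * (X u v)\<^sup>2 else 0)"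
          by (rule sum.cong[OF refl]) (use arcs_in_disjoint[OF bt J_W[OF W(1)] J_W _ W(2)] W in \<open>auto simp: block_matrix_def\<close>)
        then show ?thesis using W fin by (simp add: Y_def M_arc[OF W] power_mult_distrib algebra_simps)
      next
        case False
        have "(\<Sum>U\<in>J. (1 - (\<kappa> U)\<^sup>2) * ((X u v)\<^sup>2 * block_matrix U u v)) = 0"
          by (rule sum.neutral) (use False in \<open>auto simp: block_matrix_def\<close>)
        then show ?thesis using mult_left_mono[OF M_le[of u v], of "(X u v)\<^sup>2"] by (simp add: Y_def power_mult_distrib)
      qed
    qed
    also have "\<dots> = frob V X X - (\<Sum>W\<in>J. (1 - (\<kappa> W)\<^sup>2) * frob V (\<lambda>u v. (X u v)\<^sup>2) (block_matrix W))"
    proof -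
      have "(\<Sum>p\<in>V \<times> V. \<Sum>W\<in>J. (1 - (\<kappa> W)\<^sup>2) * ((X (fst p) (snd p))\<^sup>2 * block_matrix W (fst p) (snd p)))
          = (\<Sum>W\<in>J. \<Sum>p\<in>V \<times> V. (1 - (\<kappa> W)\<^sup>2) * ((X (fst p) (snd p))\<^sup>2 * block_matrix W (fst p) (snd p)))"
        by (rule sum.swap)
      then show ?thesis
        unfolding frob_self by (simp add: sum_subtractf split_def frob_def sum_distrib_left)
    qed
    also have "\<dots> \<le> frob V X X - (\<Sum>W\<in>J. (1 - (\<kappa> W)\<^sup>2) * ((s W - m W * q W)\<^sup>2 / (m W * q W)))"
    proof (intro diff_left_mono sum_mono mult_left_mono)
      fix W assume W: "W \<in> J"
      have "(s W - m W * q W)\<^sup>2 = q W * (frob V X (block_matrix W))\<^sup>2"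
        unfolding X_ind[OF W, symmetric] by (simp add: q_def power_mult_distrib)
      also have "(frob V X (block_matrix W))\<^sup>2 \<le> m W * frob V (\<lambda>u v. (X u v)\<^sup>2) (block_matrix W)"
        using Cauchy_Schwarz_ineq_sum[of "\<lambda>_. 1" "\<lambda>p. X (fst p) (snd p)" "arcs_in W"]
        unfolding frob_block_matrix[OF fin(1) in_V[OF W]] by (simp add: m_def split_def)
      finally have "(s W - m W * q W)\<^sup>2 \<le> q W * (m W * frob V (\<lambda>u v. (X u v)\<^sup>2) (block_matrix W))"
        using W_facts(1)[OF W] by simp
      then show "(s W - m W * q W)\<^sup>2 / (m W * q W) \<le> frob V (\<lambda>u v. (X u v)\<^sup>2) (block_matrix W)"
        using W_facts(1,2)[OF W] by (simp add: pos_divide_le_eq mult_ac)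
      show "0 \<le> 1 - (\<kappa> W)\<^sup>2" using \<kappa>(1)[OF W] by (simp add: power_le_one)
    qed
    also have "\<dots> = (\<Sum>W\<in>J. t W * ((1 + z W * \<kappa> W) * (1 - z W + z W * \<kappa> W)))"
      unfolding XX sum_subtractf[symmetric]
    proof (rule sum.cong[OF refl])
      fix W assume W: "W \<in> J"
      define k where "k = \<kappa> W"
      have k0: "0 < k" using cf(1)[OF W] by (simp add: k_def \<kappa>_def)
      have cW: "real (c W) = (1 + k) / k" using \<kappa>(2)[OF W] k0 by (simp add: k_def field_simps)
      have d: "m W * q W - s W = t W * (1 + z W * k) / k"
        unfolding W_facts(5,6)[OF W] cW using k0 by (simp add: field_simps)
      have mq: "m W * q W = t W * (1 + k) / k" unfolding W_facts(5)[OF W] cW by simp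
      have sq: "(s W - m W * q W)\<^sup>2 = (t W * (1 + z W * k) / k)\<^sup>2" using d by (metis power2_commute)
      have e: "(s W - m W * q W)\<^sup>2 / (m W * q W) = t W * (1 + z W * k)\<^sup>2 / (k * (1 + k))"
      proof -
        have "(x * g / k)\<^sup>2 / (x * (1 + k) / k) = x * g\<^sup>2 / (k * (1 + k))" if "0 < x" for x g :: real
        proof -
          have "(x * g / k)\<^sup>2 / (x * (1 + k) / k) = x * (x * g\<^sup>2 * k) / (x * (k * k * (1 + k)))"
            by (simp add: power2_eq_square mult_ac)
          then show ?thesis using k0 that by simp
        qed
        from this[OF W_facts(3)[OF W], of "1 + z W * k", folded mq] show ?thesis unfolding sq .
      qed
      have "t W * (1 + z W * k) / k - (1 - k\<^sup>2) * (t W * (1 + z W * k)\<^sup>2 / (k * (1 + k)))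
          = t W * ((1 + z W * k) * (1 - z W + z W * k))"
      proof -
        have "(1 - k\<^sup>2) * (t W * (1 + z W * k)\<^sup>2 / (k * (1 + k))) = (1 - k) * t W * (1 + z W * k)\<^sup>2 / k"
        proof -
          have "1 - k\<^sup>2 = (1 - k) * (1 + k)" by (simp add: power2_eq_square algebra_simps)
          then show ?thesis using k0 by simp
        qed
        then show ?thesis using k0 by (simp add: field_simps power2_eq_square)
      qed
      then show "m W * q W - s W - (1 - (\<kappa> W)\<^sup>2) * ((s W - m W * q W)\<^sup>2 / (m W * q W))
          = t W * ((1 + z W * \<kappa> W) * (1 - z W + z W * \<kappa> W))"
        using d e by (simp add: k_def)
    qed
    finally show ?thesis .
  qed
  have J_ne: "J \<noteq> {}"
  proof
    assume "J = {}"
    then have "tree_weight \<W> a = 0" unfolding tree_weight_def by (intro sum.neutral) (auto simp: J_def)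
    then show False using normalised by simp
  qed
  have "frob V Y (adj \<W> a) \<le> frob V P Y"
    using split_P[of Y] frob_psd_nonneg[OF fin(1) Y_psd X_psd] by (simp add: frob_commute)
  moreover have "0 \<le> frob V Y (adj \<W> a)"
    unfolding Y_adj by (rule sum_nonneg) (use W_facts(3,4) \<kappa>(1) in \<open>simp add: less_imp_le\<close>)
  ultimately have "(frob V Y (adj \<W> a))\<^sup>2 \<le> (frob V P Y)\<^sup>2" by (rule power_mono)
  also have "\<dots> \<le> frob V P P * frob V Y Y"
    using Cauchy_Schwarz_ineq_sum[of "\<lambda>p. P (fst p) (snd p)" "\<lambda>p. Y (fst p) (snd p)" "V \<times> V"]
    by (simp add: frob_def split_def power2_eq_square)
  also have "\<dots> \<le> \<mu> * (\<Sum>W\<in>J. t W * ((1 + z W * \<kappa> W) * (1 - z W + z W * \<kappa> W)))"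
    unfolding frob_P_P by (rule mult_left_mono[OF YY \<mu>_nonneg])
  also have "\<dots> < (\<Sum>W\<in>J. t W * (1 + z W * \<kappa> W))\<^sup>2"
    unfolding \<mu>_eq by (rule dense_weights_contradiction[OF fin(3) J_ne]) (use W_facts(3,4) \<kappa>(1) in blast)+
  finally show False unfolding Y_adj by simp
qed

end

section \<open>Induction over trees of blocks\<close>

context simple_graph
begin

text \<open>The induction measure. The summand has to be positive on blocks of two vertices, grow with the block, and satisfy
\<open>f b1 + f b2 < f (b1 + b2 - 1)\<close>, so that splitting and pruning both lower the measure.\<close>
definition block_size :: "'a set set \<Rightarrow> nat" where
  "block_size \<W> = (\<Sum>W\<in>\<W>. 2 * card W - 3)"

theorem block_tree_energy_bound:
  assumes "block_tree V \<W>"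
  shows "energy_bound V \<W>"
  using assms
proof (induction "block_size \<W>" arbitrary: V \<W> rule: less_induct)
  case less
  note bt = less.prems
  have fin: "finite V" "finite \<W>" using block_tree_finite[OF bt] by auto
  show ?case
  proof (cases "\<forall>W\<in>\<W>. \<forall>v\<in>W. connected_on (W - {v})")
    case False
    then obtain W c where W: "W \<in> \<W>" "c \<in> W" "\<not> connected_on (W - {c})" by blast
    obtain W1 W2 where s: "W1 \<union> W2 = W" "W1 \<inter> W2 = {c}" "W1 \<notin> \<W>" "W2 \<notin> \<W>" "W1 \<noteq> W2" "2 \<le> card W1" "2 \<le> card W2"
      "card W1 + card W2 = card W + 1" "arcs_in W = arcs_in W1 \<union> arcs_in W2" "arcs_in W1 \<inter> arcs_in W2 = {}"
      "block_tree V (\<W> - {W} \<union> {W1, W2})"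
      by (rule split_at_cut_vertex[OF bt W])
    have "block_size (\<W> - {W} \<union> {W1, W2}) = block_size (\<W> - {W}) + ((2 * card W1 - 3) + (2 * card W2 - 3))"
    proof -
      have "(\<W> - {W}) \<inter> {W1, W2} = {}" using s(3,4) by blast
      then show ?thesis using fin s(5) unfolding block_size_def by (subst sum.union_disjoint) simp_all
    qed
    moreover have "block_size \<W> = block_size (\<W> - {W}) + (2 * card W - 3)"
      unfolding block_size_def sum.remove[OF fin(2) W(1)] by simp
    ultimately have "block_size (\<W> - {W} \<union> {W1, W2}) < block_size \<W>"
      using s(6,7,8) by linarith
    from less.hyps[OF this s(11)] show ?thesis
      by (rule energy_bound_merge[OF fin(2) W(1) s(3,4,5,8,9,10)])
  next
    case True
    show ?thesis
    proof (rule ccontr)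
      assume neg: "\<not> energy_bound V \<W>"
      obtain a X where ex: "psd V X" "tree_weight \<W> a = 1" "shifted_energy V \<W> a X < 1"
        "\<And>b Y. psd V Y \<Longrightarrow> shifted_energy V \<W> a X * tree_weight \<W> b \<le> shifted_energy V \<W> b Y"
        by (rule extremal_weights_exist[OF bt neg]) blast
      interpret extremal_block_tree E V \<W> a X "shifted_energy V \<W> a X"
        by unfold_locales (use bt ex in auto)
      show False
      proof (rule some_block_not_dense)
        fix W assume W: "W \<in> \<W>" "a W \<noteq> 0"
        note WD = block_treeD[OF bt W(1)]
        have "card W = 2 \<or> (card W - 1)\<^sup>2 < card (arcs_in W)"
        proof (rule ccontr)
          assume "\<not> ?thesis"
          then have c3: "3 \<le> card W" and sparse: "card (arcs_in W) \<le> (card W - 1)\<^sup>2" using WD(3) by auto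
          obtain r where r: "branch_map V \<W> W r" using WD(5) by blast
          show False
          proof (rule no_sparse_block[OF W(1) c3 _ W(2) r _ sparse])
            fix v assume v: "v \<in> W"
            show conn_v: "connected_on (W - {v})" using True W v by blast
            let ?W' = "{U \<in> \<W> - {W}. U \<subseteq> {u \<in> V. r u \<noteq> v}} \<union> {W - {v}}"
            note pr = prune_branch[OF bt W(1) c3 r v conn_v]
            have "block_size ?W' \<le> block_size (\<W> - {W}) + (2 * card (W - {v}) - 3)"
            proof -
              have "block_size ?W' = block_size {U \<in> \<W> - {W}. U \<subseteq> {u \<in> V. r u \<noteq> v}} + block_size {W - {v}}"
                unfolding block_size_def by (rule sum.union_disjoint) (use fin pr(2) in auto)
              moreover have "block_size {U \<in> \<W> - {W}. U \<subseteq> {u \<in> V. r u \<noteq> v}} \<le> block_size (\<W> - {W})"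
                unfolding block_size_def by (rule sum_mono2) (use fin in auto)
              ultimately show ?thesis by (simp add: block_size_def)
            qed
            also have "\<dots> < block_size (\<W> - {W}) + (2 * card W - 3)" using v WD(2) c3 by simp
            also have "\<dots> = block_size \<W>"
              unfolding block_size_def sum.remove[OF fin(2) W(1)] by simp
            finally show "energy_bound {u \<in> V. r u \<noteq> v} ?W'"
              by (rule less.hyps[OF _ pr(1)])
          qed
        qed
        then show "\<exists>c f. 2 \<le> c \<and> proper_colouring W c f \<and> c * (card W - 1) \<le> card (arcs_in W)"
          using dense_block_colouring[OF WD(2,3,4)] by metis
      qed
    qed
  qed
qed

theorem connected_shifted_energy:
  assumes V: "finite V" "V \<noteq> {}" "connected_on V" and X: "psd V X" and s: "s\<^sup>2 = 1"
  shows "real (card V) - 1 \<le> (\<Sum>(u, v)\<in>V \<times> V. (X u v + s * (if E u v then 1 else 0))\<^sup>2)"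
proof (cases "card V = 1")
  case True
  then show ?thesis by (auto intro: sum_nonneg)
next
  case False
  moreover have "card V \<noteq> 0" using V(1,2) by simp
  ultimately have c2: "2 \<le> card V" by linarith
  have "branch_map V {V} V (\<lambda>u. u)" by (rule branch_mapI) auto
  then have "block_tree V {V}" using V c2 by (auto simp: block_tree_def)
  from block_tree_energy_bound[OF this, unfolded energy_bound_def, rule_format, OF X, of "\<lambda>_. s"]
  have "real (card V) - 1 \<le> (\<Sum>(u, v)\<in>V \<times> V. (s * block_matrix V u v + X u v)\<^sup>2)"
    using s by (simp add: tree_weight_def shifted_energy_def adj_def frob_self)
  also have "\<dots> = (\<Sum>(u, v)\<in>V \<times> V. (X u v + s * (if E u v then 1 else 0))\<^sup>2)"
    by (rule sum.cong) (auto simp: block_matrix_def arcs_in_def add.commute)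
  finally show ?thesis .
qed

end

section \<open>From matrices to eigenvalues\<close>

lemma sum_cnj_form_real:
  fixes v :: "complex vec"
  assumes "\<And>i j. i < n \<Longrightarrow> j < n \<Longrightarrow> A $$ (i, j) = (A $$ (j, i) :: real)"
  shows "(\<Sum>i<n. \<Sum>j<n. cnj (v $ i) * complex_of_real (A $$ (i, j)) * v $ j) \<in> \<real>"
proof -
  let ?S = "\<Sum>i<n. \<Sum>j<n. cnj (v $ i) * complex_of_real (A $$ (i, j)) * v $ j"
  have "cnj ?S = (\<Sum>i<n. \<Sum>j<n. v $ i * complex_of_real (A $$ (i, j)) * cnj (v $ j))" by simp
  also have "\<dots> = (\<Sum>j<n. \<Sum>i<n. v $ i * complex_of_real (A $$ (i, j)) * cnj (v $ j))" by (rule sum.swap)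
  also have "\<dots> = ?S"
    by (intro sum.cong refl) (simp add: assms mult_ac)
  finally show ?thesis by (simp add: Reals_cnj_iff)
qed

text \<open>Over the complex numbers the characteristic polynomial splits. An eigenvalue \<open>a\<close> with eigenvector \<open>v\<close> is the
real number \<open>v\<^sup>* A v\<close> divided by the real number \<open>v\<^sup>* v\<close>.\<close>
lemma real_symmetric_char_poly_splits:
  fixes A :: "real mat"
  assumes A: "A \<in> carrier_mat n n" and sym: "\<And>i j. i < n \<Longrightarrow> j < n \<Longrightarrow> A $$ (i, j) = A $$ (j, i)"
  obtains es where "char_poly A = (\<Prod>e\<leftarrow>es. [:- e, 1:])"
proof -
  define Ac where "Ac = map_mat complex_of_real A"
  have Ac: "Ac \<in> carrier_mat n n" using A by (simp add: Ac_def)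
  obtain as where as: "char_poly Ac = (\<Prod>a\<leftarrow>as. [:- a, 1:])" using char_poly_factorized[OF Ac] by blast
  have real: "a \<in> \<real>" if "a \<in> set as" for a
  proof -
    have "poly (char_poly Ac) a = 0" unfolding as poly_prod_list using that by (auto simp: prod_list_zero_iff)
    then have "eigenvalue Ac a" using eigenvalue_root_char_poly[OF Ac] by blast
    then obtain v where v: "v \<in> carrier_vec n" "v \<noteq> 0\<^sub>v n" "Ac *\<^sub>v v = a \<cdot>\<^sub>v v"
      using Ac by (auto simp: eigenvalue_def eigenvector_def)
    have row: "(\<Sum>j<n. complex_of_real (A $$ (i, j)) * v $ j) = a * v $ i" if "i < n" for i
    proof -
      have "(Ac *\<^sub>v v) $ i = (\<Sum>j<n. complex_of_real (A $$ (i, j)) * v $ j)"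
        using that A v(1) by (simp add: Ac_def scalar_prod_def lessThan_atLeast0)
      then show ?thesis using v that by simp
    qed
    define N where "N = (\<Sum>i<n. (cmod (v $ i))\<^sup>2)"
    have "N \<noteq> 0"
    proof
      assume "N = 0"
      then have "\<And>i. i < n \<Longrightarrow> v $ i = 0" by (simp add: N_def sum_nonneg_eq_0_iff)
      then have "v = 0\<^sub>v n" using v(1) by (intro eq_vecI) auto
      then show False using v(2) by blast
    qed
    have "(\<Sum>i<n. \<Sum>j<n. cnj (v $ i) * complex_of_real (A $$ (i, j)) * v $ j) = (\<Sum>i<n. cnj (v $ i) * (a * v $ i))"
      by (intro sum.cong refl) (simp add: row[symmetric] sum_distrib_left mult_ac)
    also have "\<dots> = a * complex_of_real N"
      unfolding N_def of_real_sum sum_distrib_left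
      by (intro sum.cong refl) (simp only: complex_norm_square mult_ac)
    finally have "a * complex_of_real N \<in> \<real>" using sum_cnj_form_real[of n A v, OF sym] by simp
    then have "a * complex_of_real N / complex_of_real N \<in> \<real>" by (rule Reals_divide) simp
    then show ?thesis using \<open>N \<noteq> 0\<close> by simp
  qed
  interpret hp: map_poly_inj_comm_ring_hom complex_of_real ..
  have "map_poly complex_of_real (char_poly A) = (\<Prod>a\<leftarrow>as. [:- a, 1:])"
    using of_real_hom.char_poly_hom[OF A, where 'a = complex] as by (simp add: Ac_def)
  also have "\<dots> = (\<Prod>a\<leftarrow>as. map_poly complex_of_real [:- Re a, 1:])"
    by (intro arg_cong[where f = prod_list] map_cong refl) (use real in \<open>auto elim!: Reals_cases\<close>)
  also have "\<dots> = map_poly complex_of_real (\<Prod>e\<leftarrow>map Re as. [:- e, 1:])"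
    by (simp add: hp.hom_prod_list o_def)
  finally have "char_poly A = (\<Prod>e\<leftarrow>map Re as. [:- e, 1:])" by simp
  then show thesis by (rule that)
qed

lemma transpose_smult: "transpose_mat (k \<cdot>\<^sub>m A) = k \<cdot>\<^sub>m transpose_mat A"
  by (rule eq_matI) auto

lemma index_mult_mat_sum:
  assumes "C \<in> carrier_mat n n" "D \<in> carrier_mat n n" "i < n" "j < n"
  shows "(C * D) $$ (i, j) = (\<Sum>k<n. C $$ (i, k) * D $$ (k, j))"
  using assms by (simp add: scalar_prod_def lessThan_atLeast0)

lemma upper_triangular_mult:
  fixes C D :: "real mat"
  assumes C: "C \<in> carrier_mat n n" "upper_triangular C" and D: "D \<in> carrier_mat n n" "upper_triangular D"
  shows "upper_triangular (C * D)" and "i < n \<Longrightarrow> (C * D) $$ (i, i) = C $$ (i, i) * D $$ (i, i)"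
proof -
  have zero: "C $$ (i, k) * D $$ (k, j) = 0" if "i < n" "k < n" "j \<le> i" "k \<noteq> i \<or> j < i" for i j k
  proof (cases "k < i")
    case True
    then have "C $$ (i, k) = 0" using upper_triangularD[OF C(2)] C(1) that by auto
    then show ?thesis by simp
  next
    case False
    then have "j < k" using that by auto
    then have "D $$ (k, j) = 0" using upper_triangularD[OF D(2)] D(1) that by auto
    then show ?thesis by simp
  qed
  show "upper_triangular (C * D)"
  proof (rule upper_triangularI)
    fix i j assume ij: "j < i" "i < dim_row (C * D)"
    then show "(C * D) $$ (i, j) = 0"
      using index_mult_mat_sum[OF C(1) D(1), of i j] zero[of i _ j] C(1) by (simp add: sum.neutral)
  qed
  assume i: "i < n"
  have "(\<Sum>k<n. C $$ (i, k) * D $$ (k, i)) = (\<Sum>k<n. if k = i then C $$ (i, i) * D $$ (i, i) else 0)"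
    by (rule sum.cong[OF refl]) (use zero[OF i, of _ i] in auto)
  then show "(C * D) $$ (i, i) = C $$ (i, i) * D $$ (i, i)"
    using i index_mult_mat_sum[OF C(1) D(1) i i] by simp
qed

lemma sum_diag_similar:
  fixes P C Q :: "real mat"
  assumes car: "P \<in> carrier_mat n n" "C \<in> carrier_mat n n" "Q \<in> carrier_mat n n" and QP: "Q * P = 1\<^sub>m n"
  shows "(\<Sum>i<n. (P * C * Q) $$ (i, i)) = (\<Sum>i<n. C $$ (i, i))"
proof -
  have comm: "(\<Sum>i<n. (Y * Z) $$ (i, i)) = (\<Sum>i<n. (Z * Y) $$ (i, i))"
    if "Y \<in> carrier_mat n n" "Z \<in> carrier_mat n n" for Y Z :: "real mat"
  proof -
    have "(\<Sum>i<n. (Y * Z) $$ (i, i)) = (\<Sum>i<n. \<Sum>k<n. Y $$ (i, k) * Z $$ (k, i))"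
      by (intro sum.cong refl) (simp add: index_mult_mat_sum[OF that])
    also have "\<dots> = (\<Sum>k<n. \<Sum>i<n. Y $$ (i, k) * Z $$ (k, i))" by (rule sum.swap)
    also have "\<dots> = (\<Sum>k<n. (Z * Y) $$ (k, k))"
      by (intro sum.cong refl) (simp add: index_mult_mat_sum[OF that(2,1)] mult.commute)
    finally show ?thesis .
  qed
  have "(\<Sum>i<n. (P * C * Q) $$ (i, i)) = (\<Sum>i<n. (Q * (P * C)) $$ (i, i))"
    using car by (intro comm) auto
  also have "Q * (P * C) = C"
    using car QP by (simp flip: assoc_mult_mat[of Q n n P n C n])
  finally show ?thesis .
qed

lemma similar_mult:
  fixes P C D Q :: "real mat"
  assumes car: "P \<in> carrier_mat n n" "C \<in> carrier_mat n n" "D \<in> carrier_mat n n" "Q \<in> carrier_mat n n"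
    and QP: "Q * P = 1\<^sub>m n"
  shows "P * C * Q * (P * D * Q) = P * (C * D) * Q"
proof -
  have cancel: "Q * (P * Z) = Z" if "Z \<in> carrier_mat n n" for Z
  proof -
    have "Q * (P * Z) = Q * P * Z" by (rule assoc_mult_mat[OF car(4,1) that, symmetric])
    then show ?thesis using QP that by simp
  qed
  have "P * C * Q * (P * D * Q) = P * (C * (Q * (P * (D * Q))))"
    using car by (simp add: assoc_mult_mat[of _ n n _ n _ n])
  also have "Q * (P * (D * Q)) = D * Q" using car by (intro cancel) simp
  also have "P * (C * (D * Q)) = P * (C * D) * Q"
    using car by (simp add: assoc_mult_mat[of _ n n _ n _ n])
  finally show ?thesis .
qed

text \<open>The matrix \<open>M\<close> is \<open>p(A)\<close> for a polynomial \<open>p\<close> that agrees with \<open>f\<close> on \<open>S\<close>, built by Newton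
interpolation: \<open>p x = f e + (x - e) * p' x\<close> where \<open>p'\<close> interpolates the difference quotient of \<open>f\<close> at \<open>e\<close>.
A triangular form of \<open>A\<close> is enough to read off the eigenvalues of \<open>p(A)\<close>, so that no orthonormal eigenbasis has
to be found.\<close>
lemma interpolated_matrix_function:
  fixes A B P Q :: "real mat" and f :: "real \<Rightarrow> real"
  assumes A: "A \<in> carrier_mat n n" "transpose_mat A = A"
    and wit: "similar_mat_wit A B P Q" and B: "upper_triangular B" and S: "finite S"
  shows "\<exists>M C. M \<in> carrier_mat n n \<and> transpose_mat M = M \<and> M * A = A * M \<and>
    C \<in> carrier_mat n n \<and> upper_triangular C \<and> M = P * C * Q \<and> (\<forall>i<n. B $$ (i, i) \<in> S \<longrightarrow> C $$ (i, i) = f (B $$ (i, i)))"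
  using S
proof (induction S arbitrary: f rule: finite_induct)
  case empty
  note w = similar_mat_witD2[OF A(1) wit]
  show ?case
    by (rule exI[of _ "0\<^sub>m n n"], rule exI[of _ "0\<^sub>m n n"]) (use A w in \<open>auto intro: eq_matI\<close>)
next
  case (insert e S)
  note w = similar_mat_witD2[OF A(1) wit]
  obtain M C where M: "M \<in> carrier_mat n n" "transpose_mat M = M" "M * A = A * M"
    and C: "C \<in> carrier_mat n n" "upper_triangular C" "M = P * C * Q"
    and CS: "\<And>i. i < n \<Longrightarrow> B $$ (i, i) \<in> S \<Longrightarrow> C $$ (i, i) = (f (B $$ (i, i)) - f e) / (B $$ (i, i) - e)"
    using insert.IH[of "\<lambda>r. (f r - f e) / (r - e)"] by blast
  define I where "I = (1\<^sub>m n :: real mat)"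
  have I: "I \<in> carrier_mat n n" by (simp add: I_def)
  define A1 where "A1 = A + (- e) \<cdot>\<^sub>m I"
  define B1 where "B1 = B + (- e) \<cdot>\<^sub>m I"
  have car: "A1 \<in> carrier_mat n n" "B1 \<in> carrier_mat n n" using A w I by (auto simp: A1_def B1_def)
  have MA1: "M * A1 = A1 * M"
    using A M I by (simp add: A1_def I_def mult_add_distrib_mat[of M n n A n] add_mult_distrib_mat[of A n n _ M n] mult_smult_distrib[of M n n _ n] mult_smult_assoc_mat[of _ n n M n])
  have A1T: "transpose_mat A1 = A1"
    using A I by (simp add: A1_def I_def transpose_add[of A n n] transpose_smult)
  have A1_sim: "A1 = P * B1 * Q"
  proof -
    have "P * B1 * Q = P * B * Q + (- e) \<cdot>\<^sub>m (P * Q)"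
      using w by (simp add: B1_def I_def mult_add_distrib_mat[of P n n B n] add_mult_distrib_mat[of "P * B" n n _ Q n] mult_smult_distrib[of P n n _ n] mult_smult_assoc_mat[of _ n n Q n])
    then show ?thesis using w by (simp add: A1_def I_def)
  qed
  define M' where "M' = f e \<cdot>\<^sub>m I + A1 * M"
  define C' where "C' = f e \<cdot>\<^sub>m I + B1 * C"
  have car': "M' \<in> carrier_mat n n" "C' \<in> carrier_mat n n"
    using I car M C by (auto simp: M'_def C'_def)
  have "transpose_mat M' = M'"
    using I car M by (simp add: M'_def transpose_add[of _ n n] transpose_smult transpose_mult[of A1 n n M n] A1T MA1 I_def)
  moreover have "M' * A = A * M'"
  proof -
    have "A1 * M * A = A1 * (A * M)" using car A M by (simp add: assoc_mult_mat[of A1 n n M n A n])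
    also have "\<dots> = A1 * A * M" using car A M by (simp add: assoc_mult_mat[of A1 n n A n M n])
    also have "A1 * A = A * A1"
      using A I by (simp add: A1_def I_def mult_add_distrib_mat[of A n n A n] add_mult_distrib_mat[of A n n _ A n] mult_smult_distrib[of A n n _ n] mult_smult_assoc_mat[of _ n n A n])
    also have "A * A1 * M = A * (A1 * M)" using car A M by (simp add: assoc_mult_mat[of A n n A1 n M n])
    finally show ?thesis
      using I A car M by (simp add: M'_def I_def mult_add_distrib_mat[of A n n _ n] add_mult_distrib_mat[of _ n n _ A n] mult_smult_distrib[of A n n _ n] mult_smult_assoc_mat[of _ n n A n])
  qed
  moreover have "upper_triangular B1"
    using B w(5) by (auto simp: upper_triangular_def B1_def I_def)
  note tri = upper_triangular_mult[OF car(2) this C(1,2)]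
  have "upper_triangular C'"
    using tri(1) car C(1) by (auto simp: upper_triangular_def C'_def I_def)
  moreover have "M' = P * C' * Q"
  proof -
    have "A1 * M = P * (B1 * C) * Q"
      unfolding A1_sim C(3) by (rule similar_mult) (use w car C(1) in auto)
    moreover have "P * C' * Q = f e \<cdot>\<^sub>m (P * Q) + P * (B1 * C) * Q"
      using w car C(1) by (simp add: C'_def I_def mult_add_distrib_mat[of P n n _ n] add_mult_distrib_mat[of _ n n _ Q n] mult_smult_distrib[of P n n _ n] mult_smult_assoc_mat[of _ n n Q n])
    ultimately show ?thesis using w by (simp add: M'_def I_def)
  qed
  moreover have "C' $$ (i, i) = f (B $$ (i, i))" if i: "i < n" "B $$ (i, i) \<in> insert e S" for i
  proof -
    have "C' $$ (i, i) = f e + (B $$ (i, i) - e) * C $$ (i, i)"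
      using i car C(1) w(5) tri(2)[OF i(1)] by (simp add: C'_def B1_def I_def)
    then show ?thesis using CS[OF i(1)] i(2) by (cases "B $$ (i, i) = e") auto
  qed
  ultimately show ?case using car' by blast
qed

lemma psd_square_of_symmetric:
  fixes M :: "real mat"
  assumes M: "M \<in> carrier_mat n n" "transpose_mat M = M"
  shows "psd {..<n} (\<lambda>i j. (M * M) $$ (i, j))"
proof (rule psd_gram_imp[where K = "{..<n}" and F = "\<lambda>k i. M $$ (k, i)"])
  fix i j assume ij: "i \<in> {..<n}" "j \<in> {..<n}"
  have "M $$ (i, k) = M $$ (k, i)" if "k < n" for k
    using arg_cong[OF M(2), of "\<lambda>Z. Z $$ (k, i)"] M(1) ij that by simp
  then show "(M * M) $$ (i, j) = (\<Sum>k<n. M $$ (k, i) * M $$ (k, j))"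
    using index_mult_mat_sum[OF M(1) M(1)] ij by simp
qed simp

text \<open>Let \<open>h\<close> be the square root of the negative part of \<open>s * x\<close>. Then \<open>X = h(A)\<^sup>2\<close> is positive semidefinite,
being the square of a symmetric matrix, and \<open>s * A + X\<close> has the positive parts of the numbers
\<open>s * x\<close> as its eigenvalues. Its squared Frobenius norm is the trace of its square, which similarity preserves.\<close>
lemma psd_shift_to_positive_part:
  fixes A :: "real mat"
  assumes A: "A \<in> carrier_mat n n" and sym: "\<And>i j. i < n \<Longrightarrow> j < n \<Longrightarrow> A $$ (i, j) = A $$ (j, i)"
  obtains X where "psd {..<n} X"
    "(\<Sum>(i, j)\<in>{..<n} \<times> {..<n}. (X i j + s * A $$ (i, j))\<^sup>2) = (\<Sum>x\<in>#proots (char_poly A). (max (s * x) 0)\<^sup>2)"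
proof -
  have AT: "transpose_mat A = A" by (rule eq_matI) (use A sym in auto)
  obtain es where es: "char_poly A = (\<Prod>e\<leftarrow>es. [:- e, 1:])"
    using real_symmetric_char_poly_splits[OF A sym] by blast
  obtain B P Q where "schur_decomposition A es = (B, P, Q)" by (metis prod_cases3)
  from schur_decomposition[OF A es this]
  have wit: "similar_mat_wit A B P Q" and B: "upper_triangular B" "diag_mat B = es" by auto
  note w = similar_mat_witD2[OF A wit]
  obtain M C where M: "M \<in> carrier_mat n n" "transpose_mat M = M"
    and C: "C \<in> carrier_mat n n" "upper_triangular C" "M = P * C * Q"
    and CB: "\<And>i. i < n \<Longrightarrow> B $$ (i, i) \<in> set es \<Longrightarrow> C $$ (i, i) = sqrt (max (- s * B $$ (i, i)) 0)"
    using interpolated_matrix_function[OF A AT wit B(1), of "set es" "\<lambda>x. sqrt (max (- s * x) 0)"] by blast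
  have B_es: "B $$ (i, i) \<in> set es" if "i < n" for i
    using that w(5) unfolding B(2)[symmetric] diag_mat_def by auto
  define G where "G = M * M + s \<cdot>\<^sub>m A"
  define D where "D = C * C + s \<cdot>\<^sub>m B"
  note CC = upper_triangular_mult[OF C(1,2) C(1,2)]
  have D: "D \<in> carrier_mat n n" "upper_triangular D"
    using C w(5) B(1) CC(1) by (auto simp: D_def upper_triangular_def)
  have Dii: "D $$ (i, i) = max (s * B $$ (i, i)) 0" if i: "i < n" for i
  proof -
    have "D $$ (i, i) = C $$ (i, i) * C $$ (i, i) + s * B $$ (i, i)"
      using i C(1) w(5) CC(2)[OF i] by (simp add: D_def)
    also have "C $$ (i, i) * C $$ (i, i) = max (- s * B $$ (i, i)) 0"
      unfolding CB[OF i B_es[OF i]] by simp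
    finally show ?thesis by simp
  qed
  have G: "G \<in> carrier_mat n n" using M A by (simp add: G_def)
  have G_sim: "G = P * D * Q"
  proof -
    have "M * M = P * (C * C) * Q"
      unfolding C(3) by (rule similar_mult) (use w C(1) in auto)
    moreover have "P * D * Q = P * (C * C) * Q + s \<cdot>\<^sub>m (P * B * Q)"
      using w C(1) by (simp add: D_def mult_add_distrib_mat[of P n n _ n] add_mult_distrib_mat[of _ n n _ Q n] mult_smult_distrib[of P n n _ n] mult_smult_assoc_mat[of _ n n Q n])
    ultimately show ?thesis using w(3) by (simp add: G_def)
  qed
  have GT: "G $$ (i, j) = G $$ (j, i)" if "i < n" "j < n" for i j
  proof -
    have "transpose_mat G = G"
      using M A AT by (simp add: G_def transpose_add[of _ n n] transpose_smult transpose_mult[of M n n M n])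
    then show ?thesis using G that by (metis index_transpose_mat(1) carrier_matD)
  qed
  have "(\<Sum>(i, j)\<in>{..<n} \<times> {..<n}. ((M * M) $$ (i, j) + s * A $$ (i, j))\<^sup>2) = (\<Sum>i<n. \<Sum>j<n. G $$ (i, j) * G $$ (j, i))"
    unfolding sum.cartesian_product
    by (rule sum.cong) (use M A GT in \<open>auto simp: G_def power2_eq_square\<close>)
  also have "\<dots> = (\<Sum>i<n. (G * G) $$ (i, i))"
    by (intro sum.cong refl) (simp add: index_mult_mat_sum[OF G G])
  also have "G * G = P * (D * D) * Q"
    unfolding G_sim by (rule similar_mult) (use w D(1) in auto)
  also have "(\<Sum>i<n. (P * (D * D) * Q) $$ (i, i)) = (\<Sum>i<n. (D * D) $$ (i, i))"
    by (rule sum_diag_similar) (use w D(1) in auto)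
  also have "\<dots> = (\<Sum>i<n. (max (s * B $$ (i, i)) 0)\<^sup>2)"
    by (intro sum.cong refl) (simp add: upper_triangular_mult(2)[OF D D] Dii power2_eq_square)
  also have "\<dots> = (\<Sum>x\<leftarrow>es. (max (s * x) 0)\<^sup>2)"
    unfolding B(2)[symmetric] diag_mat_def using w(5) by (simp add: sum_list_sum_nth lessThan_atLeast0)
  also have "\<dots> = (\<Sum>x\<in>#mset es. (max (s * x) 0)\<^sup>2)"
    by (metis mset_map sum_mset_sum_list)
  also have "mset es = proots (char_poly A)"
    unfolding es by (induction es) (simp_all add: proots_mult prod_list_zero_iff image_iff del: mult_pCons_left)
  finally show thesis using that[OF psd_square_of_symmetric[OF M]] by blast
qed

lemma sum_mset_max_zero:
  fixes K :: "real multiset"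
  shows "(\<Sum>x\<in>#K. (max x 0)\<^sup>2) = (\<Sum>x\<in>#filter_mset (\<lambda>x. 0 < x) K. x\<^sup>2)"
    and "(\<Sum>x\<in>#K. (max (- x) 0)\<^sup>2) = (\<Sum>x\<in>#filter_mset (\<lambda>x. x < 0) K. x\<^sup>2)"
  by (induction K) auto

text \<open>The sign \<open>s\<close> selects the positive or the negative square energy.\<close>
lemma square_energy_ge:
  fixes G :: "('a, 'b) pre_digraph" and vs :: "'a list"
  assumes G: "graph G" "Digraph_Component.connected G" and vs: "distinct vs" "set vs = verts G"
    and s: "s\<^sup>2 = (1 :: real)"
  shows "real (card (verts G)) - 1 \<le> (\<Sum>x\<in>#eigenvalues_mset (adjacency_matrix G vs). (max (s * x) 0)\<^sup>2)"
proof -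
  interpret graph G by (rule G(1))
  define n where "n = length vs"
  define E where "E i j \<longleftrightarrow> i < n \<and> j < n \<and> vs ! i \<rightarrow>\<^bsub>G\<^esub> vs ! j" for i j
  have sym: "v \<rightarrow>\<^bsub>G\<^esub> u" if "u \<rightarrow>\<^bsub>G\<^esub> v" for u v
    using that sym_arcs unfolding symmetric_def by (blast dest: symD)
  interpret E: simple_graph E
    by unfold_locales (use sym adj_not_same in \<open>auto simp: E_def\<close>)
  have "E.connected_on {..<n}"
    unfolding E.connected_on_def
  proof (intro allI impI)
    fix S assume S: "S \<subseteq> {..<n}" "S \<noteq> {}" "S \<noteq> {..<n}"
    then obtain i j where i: "i \<in> S" and j: "j < n" "j \<notin> S" by blast
    have in_verts: "vs ! i \<in> verts G" "vs ! j \<in> verts G"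
      using i j S vs(2) nth_mem unfolding n_def by blast+
    have "strongly_connected G"
      using symmetric_connected_imp_strongly_connected[OF sym_arcs G(2)] .
    then have "vs ! i \<rightarrow>\<^sup>*\<^bsub>G\<^esub> vs ! j" using in_verts unfolding strongly_connected_def by blast
    then have path: "(vs ! i, vs ! j) \<in> rtrancl_on (verts G) (arcs_ends G)" by (simp add: reachable_def)
    show "\<exists>u\<in>S. \<exists>v\<in>{..<n} - S. E u v"
    proof (rule ccontr)
      assume no: "\<not> ?thesis"
      from path have "vs ! j \<in> (!) vs ` S"
      proof (induction rule: rtrancl_on_induct)
        case base
        then show ?case using i by blast
      next
        case (step y z)
        then obtain k where k: "k \<in> S" "y = vs ! k" by blast
        obtain l where l: "l < n" "z = vs ! l"
          using step(2,4) vs(2) head_in_verts unfolding n_def by (metis in_set_conv_nth)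
        have "E k l" using k l step S by (auto simp: E_def)
        then show ?case using no k l by blast
      qed
      then obtain k where "k \<in> S" "vs ! j = vs ! k" by blast
      then show False using j S vs(1) unfolding n_def by (metis lessThan_iff nth_eq_iff_index_eq subsetD)
    qed
  qed
  define A where "A = adjacency_matrix G vs"
  have A: "A \<in> carrier_mat n n" by (simp add: A_def adjacency_matrix_def n_def)
  have A_E: "A $$ (i, j) = (if E i j then 1 else 0)" if "i < n" "j < n" for i j
    using that by (simp add: A_def adjacency_matrix_def n_def E_def)
  have A_sym: "A $$ (i, j) = A $$ (j, i)" if "i < n" "j < n" for i j
    using that E.E_sym by (auto simp: A_E)
  obtain X where X: "psd {..<n} X"
    "(\<Sum>(i, j)\<in>{..<n} \<times> {..<n}. (X i j + s * A $$ (i, j))\<^sup>2) = (\<Sum>x\<in>#proots (char_poly A). (max (s * x) 0)\<^sup>2)"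
    using psd_shift_to_positive_part[OF A A_sym] by blast
  have card: "card (verts G) = n" using vs distinct_card unfolding n_def by metis
  have "verts G \<noteq> {}" using G(2) by (simp add: connected_conv)
  then have "{..<n} \<noteq> {}" using card vs(2) by (metis List.finite_set card_eq_0_iff card_lessThan)
  then have "real (card {..<n}) - 1 \<le> (\<Sum>(i, j)\<in>{..<n} \<times> {..<n}. (X i j + s * (if E i j then 1 else 0))\<^sup>2)"
    using E.connected_shifted_energy[OF _ _ \<open>E.connected_on {..<n}\<close> X(1) s] by simp
  also have "\<dots> = (\<Sum>(i, j)\<in>{..<n} \<times> {..<n}. (X i j + s * A $$ (i, j))\<^sup>2)"
    by (rule sum.cong) (auto simp: A_E)
  finally show ?thesis
    unfolding X(2) eigenvalues_mset_def A_def[symmetric] using card by simp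
qed

theorem theorem1p2:
  fixes G :: "('a, 'b) pre_digraph" and vs :: "'a list"
  assumes "graph G"
    and "Digraph_Component.connected G"
    and "distinct vs" and "set vs = verts G"
  shows "min (positive_square_energy G vs) (negative_square_energy G vs)
    \<ge> real (card (verts G)) - 1"
proof -
  have "real (card (verts G)) - 1 \<le> positive_square_energy G vs"
    using square_energy_ge[OF assms, of 1] unfolding positive_square_energy_def by (simp add: sum_mset_max_zero)
  moreover have "real (card (verts G)) - 1 \<le> negative_square_energy G vs"
    using square_energy_ge[OF assms, of "-1"] unfolding negative_square_energy_def by (simp add: sum_mset_max_zero)
  ultimately show ?thesis by simp
qed

end
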